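(* ELVA is a polynomial-time algorithm: on every instance of the user-association problem (P1), the number of elementary operations performed by ELVA is bounded by a polynomial in the size of the instance.
   Context: Setting. $\mathcal{M},\mathcal{S},\mathcal{E}$ are finite nonempty sets of users, small cells and enhanced views. $d_{i,j}$ is the Euclidean distance between user $i$ and cell $j$, $R_{i,j}>0$ the data rate from $j$ to $i$, given by $R_{i,j}=W\log_2\Bigl(1+\frac{P_{t_j}g_{i,j}(d_{i,j})}{\mathcal{N}+\sum_{n\ne j}P_{t_n}g_{i,n}(d_{i,n})}\Bigr)$ ($W$ bandwidth, $P_{t_j}$ transmission power, $g_{i,j}(\cdot)$ channel gain, $\mathcal{N}$ noise power). $B$ is the size of the basic view and $E_k$ the size of enhanced view $k$; $N^b_{i,j}=\lceil B/R_{i,j}\rceil$, $N^e_{i,j,k}=\lceil E_k/R_{i,j}\rceil$; $N_j$ is the number of resource blocks of cell $j$; $w_{i,j,k}\in\{0,1\}$ indicates whether enhanced view $k$ desired by user $i$ is stored in cell $j$, subject to the cache constraint $\sum_{k}(1-\prod_{i}(1-w_{i,j,k}))\le K$ for every $j$. Problem (P1): maximize $\sum_{i,j,k}y_{i,j,k}w_{i,j,k}$ over $x_{i,j}\in\{0,1\}$, $y_{i,j,k}\in[0,1]$ subject to $\sum_j x_{i,j}=1$ for all $i$; $y_{i,j,k}\le x_{i,j}w_{i,j,k}$ for all $i,j,k$; and $\max_{i}\{x_{i,j}N^b_{i,j}\}+\sum_{i,k}y_{i,j,k}N^e_{i,j,k}\le N_j$ for all $j$. Quantities. $d_{max\_min}=\max_i\min_j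 d_{i,j}$; $R_{max\_min}$ is the rate for the pair attaining $d_{max\_min}$; $\bar N^b=B/R_{max\_min}$. For $\mathcal{A}\subseteq\mathcal{M}$, $U_j(\mathcal{A})$ is the maximum of $\sum_{i\in\mathcal{A}}\sum_k y_{i,j,k}w_{i,j,k}$ over $y_{i,j,k}\in[0,1]$ with $y_{i,j,k}\le w_{i,j,k}$ and $\sum_{i\in\mathcal{A}}\sum_k y_{i,j,k}N^e_{i,j,k}\le N_j-\max_{i\in\mathcal{A}}N^b_{i,j}$. Algorithm ELVA. For a current budget $\widehat N_j$, let $G_{i,j}(\widehat N_j)=\max\sum_k y_{i,j,k}w_{i,j,k}$ subject to $\sum_k y_{i,j,k}N^e_{i,j,k}\le\widehat N_j$, $y_{i,j,k}\in[0,1]$, and let $\Delta Q_{i,j}(\widehat N_j)=\min\{\bar N^b-N^b_{i,j},0\}\cdot T+G_{i,j}(\widehat N_j)$, where $T$ is an arbitrarily big number. Initialize $x=0$, $y=0$, $\widehat N_j=N_j-\bar N^b$ for all $j$. While some user is unassigned: choose the pair $(i^*,j^* )$, with $i^*$ an unassigned user and $j^*\in\mathcal{S}$, maximizing $\Delta Q_{i,j}(\widehat N_j)$ (ties broken by best SINR, where the SINR of $(i,j)$ is the fraction appearing inside the logarithm of $R_{i,j}$); set $x_{i^*,j^*}=1$; going through $k\in\mathcal{E}$ in descending order of $w_{i^*,j^*,k}/N^e_{i^*,j^*,k}$, set $y_{i^*,j^*,k}=\min\{\widehat N_{j^*}/N^e_{i^*,j^*,k},1\}$ and replace $\widehat N_{j^*}$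 by $\widehat N_{j^*}-y_{i^*,j^*,k}N^e_{i^*,j^*,k}$; mark $i^*$ assigned. After the loop, with $\mathcal{M}_j=\{i:x_{i,j}=1\}$, recompute $y$ for each cell $j$ as an optimal solution of the problem defining $U_j(\mathcal{M}_j)$ (a fractional knapsack problem). *)

theory Defs
  imports
    "HOL-Analysis.L2_Norm"
    "HOL-Library.Extended_Real"
    "HOL-Library.Monad_Syntax"
    "HOL-Computational_Algebra.Polynomial"
begin

section \<open>Instances\<close>

text \<open>
  Users, small cells and enhanced views are numbered from 0; the three cardinalities are part of the
  instance, so that the size of an instance is unbounded.
\<close>

record network =
  n_users :: nat
  n_cells :: nat
  n_views :: nat
  distance :: "nat \<Rightarrow> nat \<Rightarrow> real"
  bandwidth :: real
  power :: "nat \<Rightarrow> real"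
  gain :: "nat \<Rightarrow> nat \<Rightarrow> real \<Rightarrow> real"
  noise :: real
  basic_size :: real
  view_size :: "nat \<Rightarrow> real"
  blocks :: "nat \<Rightarrow> nat"
  cache :: nat
  stored :: "nat \<Rightarrow> nat \<Rightarrow> nat \<Rightarrow> real"  \<comment> \<open>\<open>w\<^sub>i\<^sub>j\<^sub>k\<close>\<close>

definition sinr :: "network \<Rightarrow> nat \<Rightarrow> nat \<Rightarrow> real" where
  "sinr I i j = power I j * gain I i j (distance I i j) /
     (noise I + (\<Sum>n \<in> {..<n_cells I} - {j}. power I n * gain I i n (distance I i n)))"

definition rate :: "network \<Rightarrow> nat \<Rightarrow> nat \<Rightarrow> real" where
  "rate I i j = bandwidth I * log 2 (1 + sinr I i j)"

definition Nb :: "network \<Rightarrow> nat \<Rightarrow> nat \<Rightarrow> real" where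
  "Nb I i j = of_int \<lceil>basic_size I / rate I i j\<rceil>"

definition Ne :: "network \<Rightarrow> nat \<Rightarrow> nat \<Rightarrow> nat \<Rightarrow> real" where
  "Ne I i j k = of_int \<lceil>view_size I k / rate I i j\<rceil>"

definition valid_network :: "network \<Rightarrow> bool" where
  "valid_network I \<longleftrightarrow>
     n_users I > 0 \<and> n_cells I > 0 \<and> n_views I > 0 \<and>
     (\<exists>dim u c. \<forall>i < n_users I. \<forall>j < n_cells I.
        distance I i j = L2_set (\<lambda>l::nat. u i l - c j l) {..<dim}) \<and>
     (\<forall>i < n_users I. \<forall>j < n_cells I. rate I i j > 0) \<and>
     basic_size I > 0 \<and> (\<forall>k < n_views I. view_size I k > 0) \<and>
     (\<forall>i < n_users I. \<forall>j < n_cells I. \<forall>k < n_views I. stored I i j k \<in> {0, 1}) \<and>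
     (\<forall>j < n_cells I.
        (\<Sum>k < n_views I. 1 - (\<Prod>i < n_users I. 1 - stored I i j k)) \<le> real (cache I))"

text \<open>
  The number of input data: the three cardinalities, bandwidth, noise power, basic view size and
  cache capacity, one transmission power and one number of blocks per cell, one size per view, one
  distance and one gain function per user and cell, and the storage indicators.
\<close>

definition instance_size :: "network \<Rightarrow> nat" where
  "instance_size I = 7 + 2 * n_cells I + n_views I + 2 * n_users I * n_cells I
     + n_users I * n_cells I * n_views I"


section \<open>Specification of ELVA\<close>

definition d_max_min :: "network \<Rightarrow> real" where
  "d_max_min I = Max ((\<lambda>i. Min (distance I i ` {..<n_cells I})) ` {..<n_users I})"

definition attains_max_min :: "network \<Rightarrow> nat \<Rightarrow> nat \<Rightarrow> bool" where
  "attains_max_min I i j \<longleftrightarrow> i < n_users I \<and> j < n_cells I \<and>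
     distance I i j = Min (distance I i ` {..<n_cells I}) \<and> distance I i j = d_max_min I"

definition G_feasible :: "network \<Rightarrow> nat \<Rightarrow> nat \<Rightarrow> real \<Rightarrow> (nat \<Rightarrow> real) set" where
  "G_feasible I i j b = {y. (\<forall>k < n_views I. 0 \<le> y k \<and> y k \<le> 1) \<and>
     (\<Sum>k < n_views I. y k * Ne I i j k) \<le> b}"

text \<open>
  For \<open>b \<ge> 0\<close> the maximum is attained.  A negative budget makes the problem infeasible, and the
  value is then \<open>-\<infinity>\<close>.
\<close>

definition G :: "network \<Rightarrow> nat \<Rightarrow> nat \<Rightarrow> real \<Rightarrow> ereal" where
  "G I i j b = (SUP y \<in> G_feasible I i j b. ereal (\<Sum>k < n_views I. y k * stored I i j k))"

definition \<Delta>Q :: "network \<Rightarrow> real \<Rightarrow> real \<Rightarrow> nat \<Rightarrow> nat \<Rightarrow> real \<Rightarrow> ereal" where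
  "\<Delta>Q I T nbar i j b = ereal (min (nbar - Nb I i j) 0 * T) + G I i j b"

definition best_pair ::
    "network \<Rightarrow> real \<Rightarrow> real \<Rightarrow> nat set \<Rightarrow> (nat \<Rightarrow> real) \<Rightarrow> nat \<Rightarrow> nat \<Rightarrow> bool" where
  "best_pair I T nbar A b i j \<longleftrightarrow>
     i \<in> {..<n_users I} - A \<and> j < n_cells I \<and>
     (\<forall>i' \<in> {..<n_users I} - A. \<forall>j' < n_cells I.
        \<Delta>Q I T nbar i' j' (b j') \<le> \<Delta>Q I T nbar i j (b j) \<and>
        (\<Delta>Q I T nbar i' j' (b j') = \<Delta>Q I T nbar i j (b j) \<longrightarrow> sinr I i' j' \<le> sinr I i j))"

definition view_order :: "network \<Rightarrow> nat \<Rightarrow> nat \<Rightarrow> nat list \<Rightarrow> bool" where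
  "view_order I i j ks \<longleftrightarrow> distinct ks \<and> set ks = {..<n_views I} \<and>
     sorted_wrt (\<lambda>k k'. stored I i j k / Ne I i j k \<ge> stored I i j k' / Ne I i j k') ks"

type_synonym assoc = "nat \<times> nat \<Rightarrow> nat"               \<comment> \<open>\<open>x\<close>, indexed by user, cell\<close>
type_synonym delivery = "nat \<times> nat \<times> nat \<Rightarrow> real"  \<comment> \<open>\<open>y\<close>, indexed by user, cell, view\<close>

primrec fill ::
    "network \<Rightarrow> nat \<Rightarrow> nat \<Rightarrow> nat list \<Rightarrow> delivery \<Rightarrow> real \<Rightarrow> delivery \<times> real" where
  "fill I i j [] y b = (y, b)"
| "fill I i j (k # ks) y b =
     (let v = min (b / Ne I i j k) 1
      in fill I i j ks (y((i, j, k) := v)) (b - v * Ne I i j k))"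

text \<open>A state consists of \<open>x\<close>, \<open>y\<close>, the current budgets and the set of assigned users.\<close>

type_synonym elva_state = "assoc \<times> delivery \<times> (nat \<Rightarrow> real) \<times> nat set"

inductive elva_iter :: "network \<Rightarrow> real \<Rightarrow> real \<Rightarrow> elva_state \<Rightarrow> elva_state \<Rightarrow> bool"
  for I T nbar where
  "best_pair I T nbar A b i j \<Longrightarrow> view_order I i j ks \<Longrightarrow> fill I i j ks y (b j) = (y', bj) \<Longrightarrow>
   elva_iter I T nbar (x, y, b, A) (x((i, j) := 1), y', b(j := bj), insert i A)"

text \<open>
  The maximum of an empty set of basic-view demands is 0, as in the load constraint of the
  user-association problem, where a cell without users contributes \<open>max\<^sub>i x\<^sub>i\<^sub>j N\<^sup>b\<^sub>i\<^sub>j = 0\<close>.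
\<close>

definition Nb_max :: "network \<Rightarrow> nat \<Rightarrow> nat set \<Rightarrow> real" where
  "Nb_max I j A = (if A = {} then 0 else Max ((\<lambda>i. Nb I i j) ` A))"

definition U_feasible :: "network \<Rightarrow> nat \<Rightarrow> nat set \<Rightarrow> (nat \<Rightarrow> nat \<Rightarrow> real) set" where
  "U_feasible I j A = {y.
     (\<forall>i\<in>A. \<forall>k < n_views I. 0 \<le> y i k \<and> y i k \<le> 1 \<and> y i k \<le> stored I i j k) \<and>
     (\<Sum>i\<in>A. \<Sum>k < n_views I. y i k * Ne I i j k) \<le> real (blocks I j) - Nb_max I j A}"

definition U_value :: "network \<Rightarrow> nat \<Rightarrow> nat set \<Rightarrow> (nat \<Rightarrow> nat \<Rightarrow> real) \<Rightarrow> real" where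
  "U_value I j A y = (\<Sum>i\<in>A. \<Sum>k < n_views I. y i k * stored I i j k)"

definition U_optimal :: "network \<Rightarrow> nat \<Rightarrow> nat set \<Rightarrow> (nat \<Rightarrow> nat \<Rightarrow> real) \<Rightarrow> bool" where
  "U_optimal I j A y \<longleftrightarrow>
     y \<in> U_feasible I j A \<and> (\<forall>y' \<in> U_feasible I j A. U_value I j A y' \<le> U_value I j A y)"

definition users_of :: "network \<Rightarrow> assoc \<Rightarrow> nat \<Rightarrow> nat set" where
  "users_of I x j = {i. i < n_users I \<and> x (i, j) = 1}"

text \<open>
  \<open>elva_output I T x y\<close>: some run of ELVA returns \<open>x\<close> and \<open>y\<close>.  Different runs come from ties in the
  pair attaining \<^term>\<open>d_max_min\<close>, in the best pair and in the order of the views, and from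
  different optimal solutions of the final problems.  If the final problem of a cell is infeasible
  (the basic view alone exceeds the blocks of the cell), no enhanced view is delivered there.
\<close>

definition elva_output :: "network \<Rightarrow> real \<Rightarrow> assoc \<Rightarrow> delivery \<Rightarrow> bool" where
  "elva_output I T x y \<longleftrightarrow> (\<exists>i0 j0 nbar b y1 b1.
     attains_max_min I i0 j0 \<and> nbar = basic_size I / rate I i0 j0 \<and>
     (\<forall>j < n_cells I. b j = real (blocks I j) - nbar) \<and>
     (elva_iter I T nbar)\<^sup>*\<^sup>* ((\<lambda>_. 0), (\<lambda>_. 0), b, {}) (x, y1, b1, {..<n_users I}) \<and>
     (\<forall>j < n_cells I.
        (if U_feasible I j (users_of I x j) \<noteq> {}
         then U_optimal I j (users_of I x j) (\<lambda>i k. y (i, j, k))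
         else (\<forall>i \<in> users_of I x j. \<forall>k < n_views I. y (i, j, k) = 0)) \<and>
        (\<forall>i < n_users I. i \<notin> users_of I x j \<longrightarrow> (\<forall>k < n_views I. y (i, j, k) = 0))))"


section \<open>Computations with counted elementary operations\<close>

text \<open>
  Unit-cost model on exact real numbers.  \<open>run m = Some (v, n)\<close> means that \<open>m\<close> terminates with result
  \<open>v\<close> after \<open>n\<close> elementary operations, \<open>run m = None\<close> that it does not terminate.  The operations
  below, including reading an input datum and evaluating a gain function, cost 1.  A function
  passed to \<open>store_c\<close> is an array updated in place; allocating one costs its length plus 1.  Loops pay
  1 per iteration and 1 on exit.  Branching on a computed truth value belongs to the comparison.
\<close>

datatype 'a comp = Comp (run: "('a \<times> nat) option")

definition ret :: "'a \<Rightarrow> 'a comp" where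
  "ret v = Comp (Some (v, 0))"

definition bind_c :: "'a comp \<Rightarrow> ('a \<Rightarrow> 'b comp) \<Rightarrow> 'b comp" where
  "bind_c m f = Comp (case run m of None \<Rightarrow> None | Some (v, a) \<Rightarrow>
     (case run (f v) of None \<Rightarrow> None | Some (r, c) \<Rightarrow> Some (r, a + c)))"

adhoc_overloading bind \<rightleftharpoons> bind_c

definition op_c :: "'a \<Rightarrow> 'a comp" where
  "op_c v = Comp (Some (v, 1))"

definition add_c :: "real \<Rightarrow> real \<Rightarrow> real comp" where "add_c a b = op_c (a + b)"
definition sub_c :: "real \<Rightarrow> real \<Rightarrow> real comp" where "sub_c a b = op_c (a - b)"
definition mul_c :: "real \<Rightarrow> real \<Rightarrow> real comp" where "mul_c a b = op_c (a * b)"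
definition div_c :: "real \<Rightarrow> real \<Rightarrow> real comp" where "div_c a b = op_c (a / b)"
definition min_c :: "real \<Rightarrow> real \<Rightarrow> real comp" where "min_c a b = op_c (min a b)"
definition max_c :: "real \<Rightarrow> real \<Rightarrow> real comp" where "max_c a b = op_c (max a b)"
definition log2_c :: "real \<Rightarrow> real comp" where "log2_c a = op_c (log 2 a)"
definition ceil_c :: "real \<Rightarrow> real comp" where "ceil_c a = op_c (of_int \<lceil>a\<rceil>)"
definition call_c :: "(real \<Rightarrow> real) \<Rightarrow> real \<Rightarrow> real comp" where "call_c f a = op_c (f a)"
definition less_c :: "'a::linorder \<Rightarrow> 'a \<Rightarrow> bool comp" where "less_c a b = op_c (a < b)"
definition eq_c :: "'a::linorder \<Rightarrow> 'a \<Rightarrow> bool comp" where "eq_c a b = op_c (a = b)"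
definition load_c :: "'a \<Rightarrow> 'a comp" where "load_c v = op_c v"
definition cons_c :: "'a \<Rightarrow> 'a list \<Rightarrow> 'a list comp" where "cons_c a l = op_c (a # l)"
definition store_c :: "('k \<Rightarrow> 'v) \<Rightarrow> 'k \<Rightarrow> 'v \<Rightarrow> ('k \<Rightarrow> 'v) comp" where
  "store_c f k v = op_c (f(k := v))"
definition new_c :: "nat \<Rightarrow> 'v \<Rightarrow> ('k \<Rightarrow> 'v) comp" where
  "new_c n v = Comp (Some ((\<lambda>_. v), n + 1))"

primrec for_c :: "'i list \<Rightarrow> ('i \<Rightarrow> 's \<Rightarrow> 's comp) \<Rightarrow> 's \<Rightarrow> 's comp" where
  "for_c [] f s = op_c s"
| "for_c (i # l) f s = do { s \<leftarrow> op_c s; s \<leftarrow> f i s; for_c l f s }"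

partial_function (option) run_while ::
    "('s \<Rightarrow> bool comp) \<Rightarrow> ('s \<Rightarrow> 's comp) \<Rightarrow> 's \<Rightarrow> ('s \<times> nat) option" where
  "run_while test body s =
     Option.bind (run (test s)) (\<lambda>(t, a).
       if t then
         Option.bind (run (body s)) (\<lambda>(s', c).
           Option.bind (run_while test body s') (\<lambda>(r, d). Some (r, 1 + a + c + d)))
       else Some (s, 1 + a))"

definition while_c :: "('s \<Rightarrow> bool comp) \<Rightarrow> ('s \<Rightarrow> 's comp) \<Rightarrow> 's \<Rightarrow> 's comp" where
  "while_c test body s = Comp (run_while test body s)"


section \<open>ELVA as a counted computation\<close>

text \<open>
  Rates, SINRs and block demands are recomputed from the input data at each use.  The maxima
  \<^term>\<open>G\<close> and the final fractional knapsack problems are solved by the greedy rule.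
\<close>

definition received_c :: "network \<Rightarrow> nat \<Rightarrow> nat \<Rightarrow> real comp" where
  "received_c I i j = do {
     p \<leftarrow> load_c (power I j);
     d \<leftarrow> load_c (distance I i j);
     h \<leftarrow> call_c (gain I i j) d;
     mul_c p h }"

definition sinr_c :: "network \<Rightarrow> nat \<Rightarrow> nat \<Rightarrow> real comp" where
  "sinr_c I i j = do {
     z \<leftarrow> load_c (noise I);
     z \<leftarrow> for_c [0..<n_cells I] (\<lambda>n z. do {
       same \<leftarrow> eq_c n j;
       if same then ret z else do { r \<leftarrow> received_c I i n; add_c z r } }) z;
     r \<leftarrow> received_c I i j;
     div_c r z }"

definition rate_c :: "network \<Rightarrow> nat \<Rightarrow> nat \<Rightarrow> real comp" where
  "rate_c I i j = do {
     r \<leftarrow> sinr_c I i j;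
     r \<leftarrow> add_c 1 r;
     r \<leftarrow> log2_c r;
     W \<leftarrow> load_c (bandwidth I);
     mul_c W r }"

definition nb_c :: "network \<Rightarrow> nat \<Rightarrow> nat \<Rightarrow> real comp" where
  "nb_c I i j = do {
     B \<leftarrow> load_c (basic_size I);
     r \<leftarrow> rate_c I i j;
     q \<leftarrow> div_c B r;
     ceil_c q }"

definition ne_c :: "network \<Rightarrow> nat \<Rightarrow> nat \<Rightarrow> nat \<Rightarrow> real comp" where
  "ne_c I i j k = do {
     E \<leftarrow> load_c (view_size I k);
     r \<leftarrow> rate_c I i j;
     q \<leftarrow> div_c E r;
     ceil_c q }"

definition nearest_c :: "network \<Rightarrow> nat \<Rightarrow> (nat \<times> real) comp" where
  "nearest_c I i = do {
     d0 \<leftarrow> load_c (distance I i 0);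
     for_c [1..<n_cells I] (\<lambda>j (j0, d0). do {
       d \<leftarrow> load_c (distance I i j);
       closer \<leftarrow> less_c d d0;
       ret (if closer then (j, d) else (j0, d0)) }) (0, d0) }"

definition nbar_c :: "network \<Rightarrow> real comp" where
  "nbar_c I = do {
     (j0, d0) \<leftarrow> nearest_c I 0;
     (i0, j0, d0) \<leftarrow> for_c [1..<n_users I] (\<lambda>i (i0, j0, d0). do {
       (j, d) \<leftarrow> nearest_c I i;
       farther \<leftarrow> less_c d0 d;
       ret (if farther then (i, j, d) else (i0, j0, d0)) }) (0, j0, d0);
     B \<leftarrow> load_c (basic_size I);
     r \<leftarrow> rate_c I i0 j0;
     div_c B r }"

text \<open>Insertion sort of pairs of a user and a view, by descending ratio of gain and demand in cell \<open>j\<close>.\<close>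

definition ratio_c :: "network \<Rightarrow> nat \<Rightarrow> nat \<times> nat \<Rightarrow> real comp" where
  "ratio_c I j p = (case p of (i, k) \<Rightarrow> do {
     w \<leftarrow> load_c (stored I i j k);
     n \<leftarrow> ne_c I i j k;
     div_c w n })"

primrec insert_c ::
    "network \<Rightarrow> nat \<Rightarrow> nat \<times> nat \<Rightarrow> (nat \<times> nat) list \<Rightarrow> (nat \<times> nat) list comp" where
  "insert_c I j p [] = cons_c p []"
| "insert_c I j p (q # l) = do {
     q \<leftarrow> load_c q;
     a \<leftarrow> ratio_c I j p;
     b \<leftarrow> ratio_c I j q;
     later \<leftarrow> less_c a b;
     if later then do { l \<leftarrow> insert_c I j p l; cons_c q l }
     else do { l \<leftarrow> cons_c q l; cons_c p l } }"

definition insert_views_c ::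
    "network \<Rightarrow> nat \<Rightarrow> nat \<Rightarrow> (nat \<times> nat) list \<Rightarrow> (nat \<times> nat) list comp" where
  "insert_views_c I j i l = for_c [0..<n_views I] (\<lambda>k l. insert_c I j (i, k) l) l"

definition dq_c :: "network \<Rightarrow> real \<Rightarrow> real \<Rightarrow> nat \<Rightarrow> nat \<Rightarrow> real \<Rightarrow> ereal comp" where
  "dq_c I T nbar i j b = do {
     n \<leftarrow> nb_c I i j;
     t \<leftarrow> sub_c nbar n;
     t \<leftarrow> min_c t 0;
     t \<leftarrow> mul_c t T;
     infeasible \<leftarrow> less_c b 0;
     if infeasible then ret (-\<infinity>)
     else do {
       l \<leftarrow> insert_views_c I j i [];
       (t, b) \<leftarrow> for_c l (\<lambda>(i, k) (t, b). do {
         n \<leftarrow> ne_c I i j k;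
         v \<leftarrow> div_c b n;
         v \<leftarrow> min_c v 1;
         w \<leftarrow> load_c (stored I i j k);
         g \<leftarrow> mul_c v w;
         t \<leftarrow> add_c t g;
         u \<leftarrow> mul_c v n;
         b \<leftarrow> sub_c b u;
         ret (t, b) }) (t, b);
       ret (ereal t) } }"

type_synonym candidate = "nat \<times> nat \<times> ereal \<times> real"

definition better_c :: "ereal \<Rightarrow> real \<Rightarrow> candidate option \<Rightarrow> bool comp" where
  "better_c q s best = (case best of
     None \<Rightarrow> op_c True
   | Some (i0, j0, q0, s0) \<Rightarrow> do {
       greater \<leftarrow> less_c q0 q;
       if greater then ret True
       else do {
         tie \<leftarrow> eq_c q0 q;
         if tie then less_c s0 s else ret False } })"

definition select_c ::
    "network \<Rightarrow> real \<Rightarrow> real \<Rightarrow> (nat \<Rightarrow> real) \<Rightarrow> (nat \<Rightarrow> bool) \<Rightarrow> candidate option comp" where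
  "select_c I T nbar b assigned =
     for_c [0..<n_users I] (\<lambda>i best. do {
       a \<leftarrow> load_c (assigned i);
       if a then ret best
       else for_c [0..<n_cells I] (\<lambda>j best. do {
         bj \<leftarrow> load_c (b j);
         q \<leftarrow> dq_c I T nbar i j bj;
         s \<leftarrow> sinr_c I i j;
         better \<leftarrow> better_c q s best;
         ret (if better then Some (i, j, q, s) else best) }) best }) None"

type_synonym machine_state = "assoc \<times> delivery \<times> (nat \<Rightarrow> real) \<times> (nat \<Rightarrow> bool)"

definition unassigned_c :: "network \<Rightarrow> machine_state \<Rightarrow> bool comp" where
  "unassigned_c I = (\<lambda>(x, y, b, assigned).
     for_c [0..<n_users I] (\<lambda>i found. do {
       a \<leftarrow> load_c (assigned i);
       ret (if a then found else True) }) False)"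

text \<open>The selection fails only if every user is assigned, that is, never inside the while loop.\<close>

definition round_c :: "network \<Rightarrow> real \<Rightarrow> real \<Rightarrow> machine_state \<Rightarrow> machine_state comp" where
  "round_c I T nbar = (\<lambda>(x, y, b, assigned). do {
     best \<leftarrow> select_c I T nbar b assigned;
     case best of
       None \<Rightarrow> ret (x, y, b, assigned)
     | Some (i, j, _) \<Rightarrow> do {
         x \<leftarrow> store_c x (i, j) 1;
         l \<leftarrow> insert_views_c I j i [];
         bj \<leftarrow> load_c (b j);
         (y, bj) \<leftarrow> for_c l (\<lambda>(i, k) (y, bj). do {
           n \<leftarrow> ne_c I i j k;
           v \<leftarrow> div_c bj n;
           v \<leftarrow> min_c v 1;
           y \<leftarrow> store_c y (i, j, k) v;
           u \<leftarrow> mul_c v n;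
           bj \<leftarrow> sub_c bj u;
           ret (y, bj) }) (y, bj);
         b \<leftarrow> store_c b j bj;
         assigned \<leftarrow> store_c assigned i True;
         ret (x, y, b, assigned) } })"

definition recompute_c :: "network \<Rightarrow> assoc \<Rightarrow> nat \<Rightarrow> delivery \<Rightarrow> delivery comp" where
  "recompute_c I x j y = do {
     (l, m) \<leftarrow> for_c [0..<n_users I] (\<lambda>i (l, m). do {
       a \<leftarrow> load_c (x (i, j));
       a \<leftarrow> eq_c a 1;
       if a then do {
         l \<leftarrow> insert_views_c I j i l;
         n \<leftarrow> nb_c I i j;
         m \<leftarrow> max_c m n;
         ret (l, m) }
       else ret (l, m) }) ([], 0);
     N \<leftarrow> load_c (real (blocks I j));
     b \<leftarrow> sub_c N m;
     infeasible \<leftarrow> less_c b 0;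
     if infeasible then for_c l (\<lambda>(i, k) y. store_c y (i, j, k) 0) y
     else do {
       (y, b) \<leftarrow> for_c l (\<lambda>(i, k) (y, b). do {
         n \<leftarrow> ne_c I i j k;
         v \<leftarrow> div_c b n;
         v \<leftarrow> min_c v 1;
         w \<leftarrow> load_c (stored I i j k);
         v \<leftarrow> min_c v w;
         y \<leftarrow> store_c y (i, j, k) v;
         u \<leftarrow> mul_c v n;
         b \<leftarrow> sub_c b u;
         ret (y, b) }) (y, b);
       ret y } }"

definition elva_c :: "network \<Rightarrow> real \<Rightarrow> (assoc \<times> delivery) comp" where
  "elva_c I T = do {
     x \<leftarrow> new_c (n_users I * n_cells I) 0;
     y \<leftarrow> new_c (n_users I * n_cells I * n_views I) 0;
     assigned \<leftarrow> new_c (n_users I) False;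
     nbar \<leftarrow> nbar_c I;
     b \<leftarrow> new_c (n_cells I) 0;
     b \<leftarrow> for_c [0..<n_cells I] (\<lambda>j b. do {
       N \<leftarrow> load_c (real (blocks I j));
       v \<leftarrow> sub_c N nbar;
       store_c b j v }) b;
     (x, y, b, assigned) \<leftarrow>
       while_c (unassigned_c I) (round_c I T nbar) (x, y, b, assigned);
     y \<leftarrow> for_c [0..<n_cells I] (recompute_c I x) y;
     ret (x, y) }"

end

theory Submission
  imports Defs
begin

text \<open>
  The value \<^term>\<open>G\<close> and the final problems \<^term>\<open>U_optimal\<close> are fractional knapsacks, for which filling
  by descending ratio of gain to demand is optimal.  So the machine compares pairs by their exact
  values and simulates the abstract algorithm step by step.  Every pass of the main loop assigns one
  more user, and every other loop runs over users, cells, views, or pairs of a user and a view.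
\<close>

section \<open>Counted computations\<close>

text \<open>Cost and correctness cannot be proved separately: a list has at most users times views
  entries because its pairs are distinct, and the main loop stops because the selection really finds
  an unassigned user. Hence the single judgement \<open>runs\<close>, which asserts termination, a
  cost bound and a postcondition together. The specification is nondeterministic (ties, order of
  views, choice of optimal solutions), so it suffices that the one run made by the machine is among
  the permitted ones; ties fall to the scanning order. Two points need care. Budgets may be
  negative, since the reference demand can exceed the blocks of a cell: \<open>G\<close> is then
  \<open>-\<infinity>\<close>, and \<open>fill\<close> writes negative values which the machine must
  reproduce. The final recomputation writes only the entries of users of a cell, so the main loop
  has to leave all other entries of \<open>y\<close> at 0. Each procedure has a symbolic cost bound,
  an arithmetic expression in the three cardinalities. These bounds stay folded in later proofs and
  are expanded only to show that the last one is polynomial.\<close>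

definition runs :: "'a comp \<Rightarrow> nat \<Rightarrow> ('a \<Rightarrow> bool) \<Rightarrow> bool" where
  "runs m N Q \<longleftrightarrow> (\<exists>v c. run m = Some (v, c) \<and> c \<le> N \<and> Q v)"

lemmas op_defs = add_c_def sub_c_def mul_c_def div_c_def min_c_def max_c_def log2_c_def ceil_c_def
  call_c_def less_c_def eq_c_def load_c_def cons_c_def store_c_def

lemma runs_mono: "runs m N P \<Longrightarrow> N \<le> N' \<Longrightarrow> (\<And>v. P v \<Longrightarrow> Q v) \<Longrightarrow> runs m N' Q"
  unfolding runs_def by (meson le_trans)

lemma runs_le: "runs m N Q \<Longrightarrow> N \<le> N' \<Longrightarrow> runs m N' Q"
  by (rule runs_mono)

lemma runs_ret: "Q v \<Longrightarrow> runs (ret v) 0 Q"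
  by (simp add: runs_def ret_def)

lemma runs_op: "Q v \<Longrightarrow> runs (op_c v) 1 Q"
  by (simp add: runs_def op_c_def)

lemma runs_new: "Q (\<lambda>_. v) \<Longrightarrow> runs (new_c n v) (n + 1) Q"
  by (simp add: runs_def new_c_def)

lemma runs_bind:
  "runs m N P \<Longrightarrow> (\<And>v. P v \<Longrightarrow> runs (f v) N' Q) \<Longrightarrow> runs (bind_c m f) (N + N') Q"
  unfolding runs_def bind_c_def by (fastforce intro: add_mono)

text \<open>For steps whose result is known exactly: the value is substituted into the continuation,
  so the next rule meets a concrete program instead of a hypothesis about a variable.\<close>

lemma runs_bind_eq:
  "runs m N (\<lambda>v. v = a) \<Longrightarrow> runs (f a) N' Q \<Longrightarrow> runs (bind_c m f) (N + N') Q"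
  by (erule runs_bind) simp

lemma runs_bind_op: "runs (f v) N Q \<Longrightarrow> runs (bind_c (op_c v) f) (1 + N) Q"
  by (rule runs_bind_eq[OF runs_op[of "\<lambda>x. x = v" for v, OF refl]])

lemma runs_bind_pair:
  "runs m N P \<Longrightarrow> (\<And>a b. P (a, b) \<Longrightarrow> runs (f a b) N' Q) \<Longrightarrow>
   runs (bind_c m (\<lambda>(a, b). f a b)) (N + N') Q"
  by (erule runs_bind) auto

lemma runs_bind_triple:
  "runs m N P \<Longrightarrow> (\<And>a b c. P (a, b, c) \<Longrightarrow> runs (f a b c) N' Q) \<Longrightarrow>
   runs (bind_c m (\<lambda>(a, b, c). f a b c)) (N + N') Q"
  by (erule runs_bind) auto

lemma runs_if:
  "(P \<Longrightarrow> runs m N Q) \<Longrightarrow> (\<not> P \<Longrightarrow> runs m' N' Q) \<Longrightarrow> runs (if P then m else m') (max N N') Q"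
  unfolding runs_def by (auto simp: le_max_iff_disj)

text \<open>The invariant is indexed by the processed prefix. Each pass pays the body plus one unit
  of the loop itself, and the exit pays the last unit.\<close>

lemma runs_for_list:
  assumes "\<And>xs i ys s. l = xs @ i # ys \<Longrightarrow> P xs s \<Longrightarrow> runs (f i s) N (P (xs @ [i]))" and "P [] s"
  shows "runs (for_c l f s) (length l * (N + 1) + 1) (P l)"
proof -
  have "runs (for_c zs f s) (length zs * (N + 1) + 1) (P l)" if "l = xs @ zs" "P xs s" for xs zs s
    using that
  proof (induction zs arbitrary: xs s)
    case Nil
    then show ?case by (simp add: runs_def op_c_def)
  next
    case (Cons i zs)
    have "runs (for_c (i # zs) f s) (1 + (N + (length zs * (N + 1) + 1))) (P l)"
      unfolding for_c.simps
      by (rule runs_bind_op, rule runs_bind[OF assms(1)[OF Cons.prems]], rule Cons.IH)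
        (use Cons.prems in auto)
    then show ?case by (rule runs_le) simp
  qed
  from this[of "[]" l s] show ?thesis using assms(2) by simp
qed

text \<open>A prefix of \<open>[a..<b]\<close> is determined by its length, so the invariant can be
  indexed by the next number to be processed.\<close>

lemma runs_for_upt:
  assumes "\<And>i s. a \<le> i \<Longrightarrow> i < b \<Longrightarrow> P i s \<Longrightarrow> runs (f i s) N (P (Suc i))" and "P a s" and "a \<le> b"
  shows "runs (for_c [a..<b] f s) ((b - a) * (N + 1) + 1) (P b)"
proof -
  have "runs (for_c [a..<b] f s) (length [a..<b] * (N + 1) + 1) (\<lambda>s. P (a + length [a..<b]) s)"
  proof (rule runs_for_list[where P = "\<lambda>xs. P (a + length xs)"])
    fix xs i ys s assume *: "[a..<b] = xs @ i # ys" and P: "P (a + length xs) s"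
    have "length xs < length [a..<b]" unfolding * by simp
    moreover have "i = [a..<b] ! length xs" unfolding * by simp
    ultimately have "i = a + length xs" "i < b" by auto
    then show "runs (f i s) N (P (a + length (xs @ [i])))" using assms(1)[of i s] P by simp
  qed (use assms in auto)
  then show ?thesis using assms(3) by simp
qed

text \<open>The index of \<open>P\<close> is the exact number of passes left. It decides the test
  and drops by one in each pass, which yields termination and the count; the last
  \<open>Nt + 1\<close> pays for the failing test.\<close>

lemma runs_while:
  assumes test: "\<And>n s. P n s \<Longrightarrow> runs (test s) Nt (\<lambda>t. t \<longleftrightarrow> n > 0)"
    and body: "\<And>n s. P (Suc n) s \<Longrightarrow> runs (body s) Nr (P n)"
    and "P n s"
  shows "runs (while_c test body s) (n * (Nt + Nr + 1) + Nt + 1) (P 0)"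
  using assms(3)
proof (induction n arbitrary: s)
  case 0
  from test[OF 0] obtain c where "run (test s) = Some (False, c)" "c \<le> Nt"
    by (auto simp: runs_def)
  \<comment> \<open>The unfolding equation is instantiated so that exactly this call of the
    recursive function is unfolded.\<close>
  with 0 show ?case by (simp add: runs_def while_c_def run_while.simps[of test body s])
next
  case (Suc n)
  from test[OF Suc.prems] obtain c where c: "run (test s) = Some (True, c)" "c \<le> Nt"
    by (auto simp: runs_def)
  from body[OF Suc.prems] obtain s' d where d: "run (body s) = Some (s', d)" "d \<le> Nr" "P n s'"
    by (auto simp: runs_def)
  from Suc.IH[OF d(3)] obtain r e where
    e: "run_while test body s' = Some (r, e)" "e \<le> n * (Nt + Nr + 1) + Nt + 1" "P 0 r"
    by (auto simp: runs_def while_c_def)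
  have "run (while_c test body s) = Some (r, 1 + c + d + e)"
    by (simp add: while_c_def run_while.simps[of test body s] c d e)
  moreover have "1 + c + d + e \<le> Suc n * (Nt + Nr + 1) + Nt + 1"
    using c d e by simp
  ultimately show ?case using e(3) unfolding runs_def by blast
qed


section \<open>Rates and demands\<close>

text \<open>Per cell: one comparison, four operations for a received power, one addition, one loop
  unit. Outside: the noise, the loop exit, the wanted signal (4) and the division.\<close>

definition sinr_cost :: "network \<Rightarrow> nat" where
  "sinr_cost I = n_cells I * 7 + 7"

lemma runs_received:
  "runs (received_c I i j) 4 (\<lambda>v. v = power I j * gain I i j (distance I i j))"
  by (simp add: runs_def received_c_def op_defs op_c_def bind_c_def)

lemma runs_sinr: "runs (sinr_c I i j) (sinr_cost I) (\<lambda>v. v = sinr I i j)"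
proof -
  let ?r = "\<lambda>n. power I n * gain I i n (distance I i n)"
  have loop: "runs (for_c [0..<n_cells I] (\<lambda>n z. bind_c (eq_c n j) (\<lambda>same.
      if same then ret z else bind_c (received_c I i n) (add_c z))) (noise I))
     ((n_cells I - 0) * (6 + 1) + 1)
     (\<lambda>z. z = noise I + (\<Sum>n \<in> {..<n_cells I} - {j}. ?r n))"
  proof (rule runs_for_upt[where P = "\<lambda>m z. z = noise I + (\<Sum>n \<in> {..<m} - {j}. ?r n)"])
    fix m z assume "z = noise I + (\<Sum>n \<in> {..<m} - {j}. ?r n)"
    moreover have "{..<Suc m} - {j} = (if m = j then {..<m} - {j} else insert m ({..<m} - {j}))"
      by auto
    ultimately show "runs (bind_c (eq_c m j) (\<lambda>same.
        if same then ret z else bind_c (received_c I i m) (add_c z))) 6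
       (\<lambda>z. z = noise I + (\<Sum>n \<in> {..<Suc m} - {j}. ?r n))"
      by (auto simp: runs_def received_c_def op_defs op_c_def bind_c_def ret_def)
  qed auto
  show ?thesis
    unfolding sinr_c_def load_c_def div_c_def
    by (rule runs_le)
      (rule runs_bind_op runs_bind_eq[OF loop] runs_bind_eq[OF runs_received] runs_op
        | simp add: sinr_def sinr_cost_def)+
qed

definition rate_cost :: "network \<Rightarrow> nat" where
  "rate_cost I = sinr_cost I + 4"

lemma runs_rate: "runs (rate_c I i j) (rate_cost I) (\<lambda>v. v = rate I i j)"
  unfolding rate_c_def op_defs
  by (rule runs_le)
    (rule runs_bind_op runs_bind_eq[OF runs_sinr] runs_op | simp add: rate_def rate_cost_def)+

lemma runs_nb: "runs (nb_c I i j) (rate_cost I + 3) (\<lambda>v. v = Nb I i j)"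
  unfolding nb_c_def op_defs
  by (rule runs_le) (rule runs_bind_op runs_bind_eq[OF runs_rate] runs_op | simp add: Nb_def)+

lemma runs_ne: "runs (ne_c I i j k) (rate_cost I + 3) (\<lambda>v. v = Ne I i j k)"
  unfolding ne_c_def op_defs
  by (rule runs_le) (rule runs_bind_op runs_bind_eq[OF runs_rate] runs_op | simp add: Ne_def)+

section \<open>Nearest cells and the reference demand\<close>

definition nearest_cost :: "network \<Rightarrow> nat" where
  "nearest_cost I = n_cells I * 3 + 2"

text \<open>Cell 0 is the initial candidate, so the loop starts at 1. The invariant compares with
  the scanned cells one by one; \<open>Min\<close> is formed only at the end.\<close>

lemma runs_nearest:
  assumes "n_cells I > 0"
  shows "runs (nearest_c I i) (nearest_cost I) (\<lambda>(j, d). j < n_cells I \<and> d = distance I i j \<and>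
    d = Min (distance I i ` {..<n_cells I}))"
proof -
  let ?P = "\<lambda>m (j, d). j < n_cells I \<and> d = distance I i j \<and> (\<forall>j' < m. d \<le> distance I i j')"
  have loop: "runs (for_c [1..<n_cells I] (\<lambda>j (j0, d0). bind_c (load_c (distance I i j)) (\<lambda>d.
      bind_c (less_c d d0) (\<lambda>closer. ret (if closer then (j, d) else (j0, d0))))) (0, distance I i 0))
     ((n_cells I - 1) * (2 + 1) + 1) (?P (n_cells I))"
  proof (rule runs_for_upt[where P = ?P])
    fix j s assume "j < n_cells I" "?P j s"
    then show "runs ((case s of (j0, d0) \<Rightarrow> bind_c (load_c (distance I i j)) (\<lambda>d.
        bind_c (less_c d d0) (\<lambda>closer. ret (if closer then (j, d) else (j0, d0)))))) 2 (?P (Suc j))"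
      by (auto simp: runs_def op_defs op_c_def bind_c_def ret_def less_Suc_eq) force+
  qed (use assms in auto)
  have "?P (n_cells I) s \<Longrightarrow> (case s of (j, d) \<Rightarrow> j < n_cells I \<and> d = distance I i j \<and>
    d = Min (distance I i ` {..<n_cells I}))" for s
    by (auto intro!: Min_eqI[symmetric])
  then have "runs (nearest_c I i) (1 + ((n_cells I - 1) * (2 + 1) + 1)) (\<lambda>(j, d). j < n_cells I \<and> d = distance I i j \<and>
    d = Min (distance I i ` {..<n_cells I}))"
    unfolding nearest_c_def load_c_def
    by (intro runs_bind_op) (rule runs_mono[OF loop[unfolded load_c_def]], auto)
  then show ?thesis by (rule runs_le) (simp add: nearest_cost_def)
qed

definition nbar_cost :: "network \<Rightarrow> nat" where
  "nbar_cost I = n_users I * (nearest_cost I + 2) + nearest_cost I + rate_cost I + 3"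

text \<open>The strict comparison keeps the earliest of several farthest users. The specification
  admits every pair attaining the value, hence the existential postcondition.\<close>

lemma runs_nbar:
  assumes "n_cells I > 0" "n_users I > 0"
  shows "runs (nbar_c I) (nbar_cost I) (\<lambda>nbar. \<exists>i0 j0. attains_max_min I i0 j0 \<and>
    nbar = basic_size I / rate I i0 j0)"
proof -
  let ?D = "\<lambda>i. Min (distance I i ` {..<n_cells I})"
  let ?P = "\<lambda>m (i, j, d). i < n_users I \<and> j < n_cells I \<and> d = distance I i j \<and> d = ?D i \<and>
    (\<forall>i' < m. ?D i' \<le> d)"
  let ?body = "\<lambda>i (i0, j0, d0). bind_c (nearest_c I i) (\<lambda>(j, d).
      bind_c (less_c d0 d) (\<lambda>farther. ret (if farther then (i, j, d) else (i0, j0, d0))))"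
  have loop: "runs (for_c [1..<n_users I] ?body (0, j, d))
     ((n_users I - 1) * (nearest_cost I + (1 + 0) + 1) + 1) (?P (n_users I))"
    if "j < n_cells I" "d = distance I 0 j" "d = ?D 0" for j d
  proof (rule runs_for_upt[where P = ?P])
    fix i s assume i: "i < n_users I" and "?P i s"
    then obtain i0 j0 d0 where s: "s = (i0, j0, d0)" and P: "?P i (i0, j0, d0)" by (cases s) auto
    show "runs (?body i s) (nearest_cost I + (1 + 0)) (?P (Suc i))"
      unfolding s prod.case
    proof (rule runs_bind[OF runs_nearest[OF assms(1)]])
      fix v assume v: "case v of (j, d) \<Rightarrow> j < n_cells I \<and> d = distance I i j \<and> d = ?D i"
      obtain j d where jd: "v = (j, d)" by (cases v)
      show "runs (case v of (j, d) \<Rightarrow> bind_c (less_c d0 d) (\<lambda>farther.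
          ret (if farther then (i, j, d) else (i0, j0, d0)))) (1 + 0) (?P (Suc i))"
        unfolding jd prod.case less_c_def
        by (intro runs_bind_op runs_ret) (use v jd i P in \<open>auto simp: less_Suc_eq intro: less_imp_le le_less_trans\<close>)
    qed
  qed (use assms that in auto)
  have fin: "attains_max_min I i j" if "?P (n_users I) (i, j, d)" for i j d
    using that by (auto simp: attains_max_min_def d_max_min_def intro!: Max_eqI[symmetric])
  show ?thesis
    unfolding nbar_c_def
    apply (rule runs_le)
     apply (rule runs_bind_pair[OF runs_nearest[OF assms(1)]])
     apply (rule runs_bind_triple[OF loop])
        apply (auto)[3]
     apply (unfold load_c_def div_c_def)
     apply (rule runs_bind_op)
     apply (rule runs_bind_eq[OF runs_rate])
     apply (rule runs_op)
     apply (intro exI conjI)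
      apply (erule fin)
     apply (rule refl)
    using mult_le_mono1[of "n_users I - 1" "n_users I" "nearest_cost I + 2"]
    apply (simp add: nbar_cost_def)
    done
qed


section \<open>Sorting the views\<close>

text \<open>The sign turns the ascending order of \<open>insort_key\<close> into descending
  ratios.\<close>

abbreviation ratio_key :: "network \<Rightarrow> nat \<Rightarrow> nat \<times> nat \<Rightarrow> real" where
  "ratio_key I j \<equiv> \<lambda>(i, k). - (stored I i j k / Ne I i j k)"

lemma runs_ratio: "runs (ratio_c I j p) (rate_cost I + 5) (\<lambda>v. v = - ratio_key I j p)"
proof (cases p)
  case (Pair i k)
  show ?thesis
    unfolding Pair ratio_c_def prod.case op_defs
    by (rule runs_le) (rule runs_bind_op runs_bind_eq[OF runs_ne] runs_op | simp)+
qed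

text \<open>The machine moves past \<open>q\<close> exactly when the ratio of \<open>p\<close> is
  strictly smaller, which is the branching of \<open>insort_key\<close> on the negated ratios, ties
  included. Both ratios are recomputed at every comparison, hence twice the rate cost.\<close>

lemma runs_insert:
  "runs (insert_c I j p l) (length l * (2 * rate_cost I + 13) + 1)
    (\<lambda>l'. l' = insort_key (ratio_key I j) p l)"
proof (induction l)
  case Nil
  show ?case by (simp add: runs_def op_defs op_c_def)
next
  case (Cons q l)
  show ?case
    unfolding insert_c.simps op_defs
    apply (rule runs_le)
    apply (rule runs_bind_op runs_bind_eq[OF runs_ratio] runs_if runs_bind_eq[OF Cons.IH]
        runs_op)+
       apply (auto simp: not_less)[1]
       apply (rule runs_bind_op runs_op)+
       apply (auto simp: not_less)[1]
    by simp
qed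

definition insert_cost :: "network \<Rightarrow> nat" where
  "insert_cost I = n_users I * n_views I * (2 * rate_cost I + 13) + 1"

definition insert_views_cost :: "network \<Rightarrow> nat" where
  "insert_views_cost I = n_views I * (insert_cost I + 1) + 1"

text \<open>One notion for both kinds of knapsack: \<open>A\<close> is a single user for
  \<open>G\<close> and all users of a cell for the final problem. The inclusion in the set of users
  makes \<open>A\<close> finite and bounds the length of \<open>l\<close>.\<close>

definition view_list :: "network \<Rightarrow> nat \<Rightarrow> nat set \<Rightarrow> (nat \<times> nat) list \<Rightarrow> bool" where
  "view_list I j A l \<longleftrightarrow> A \<subseteq> {..<n_users I} \<and> distinct l \<and> set l = A \<times> {..<n_views I} \<and>
     sorted (map (ratio_key I j) l)"

lemma view_list_empty: "view_list I j {} []"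
  by (simp add: view_list_def)

lemma length_le_product:
  assumes "distinct l" "set l \<subseteq> {..<m} \<times> {..<n}"
  shows "length l \<le> m * n"
proof -
  have "length l = card (set l)"
    using assms(1) by (rule distinct_card[symmetric])
  also have "\<dots> \<le> card ({..<m} \<times> {..<n})"
    using assms(2) by (intro card_mono) auto
  finally show ?thesis by simp
qed

lemma runs_insert_views:
  assumes l: "view_list I j A l" and i: "i < n_users I" "i \<notin> A"
  shows "runs (insert_views_c I j i l) (insert_views_cost I) (view_list I j (insert i A))"
proof -
  let ?P = "\<lambda>m l. distinct l \<and> set l = A \<times> {..<n_views I} \<union> {i} \<times> {..<m} \<and>
     sorted (map (ratio_key I j) l)"
  have "runs (insert_views_c I j i l) ((n_views I - 0) * (insert_cost I + 1) + 1) (?P (n_views I))"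
    unfolding insert_views_c_def
  proof (rule runs_for_upt[where P = ?P])
    fix k l assume k: "k < n_views I" and P: "?P k l"
    have len: "length l \<le> n_users I * n_views I"
      using l P k i by (intro length_le_product) (auto simp: view_list_def)
    have "(i, k) \<notin> set l" using P i by auto
    moreover have "{i} \<times> {..<Suc k} = insert (i, k) ({i} \<times> {..<k})" by auto
    ultimately have "?P (Suc k) (insort_key (ratio_key I j) (i, k) l)"
      using P by (simp add: distinct_insort set_insort_key sorted_insort_key)
    moreover have "length l * (2 * rate_cost I + 13) + 1 \<le> insert_cost I"
      using mult_le_mono1[OF len, of "2 * rate_cost I + 13"] by (simp only: insert_cost_def add_le_mono1)
    ultimately show "runs (insert_c I j (i, k) l) (insert_cost I) (?P (Suc k))"
      by (intro runs_mono[OF runs_insert]) simp_all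
  qed (use l in \<open>auto simp: view_list_def\<close>)
  then show ?thesis
    by (rule runs_mono) (use l i in \<open>auto simp: insert_views_cost_def view_list_def\<close>)
qed

lemma view_list_length: "view_list I j A l \<Longrightarrow> length l \<le> n_users I * n_views I"
  by (rule length_le_product) (auto simp: view_list_def)


section \<open>Fractional knapsack\<close>

text \<open>The cap \<open>c\<close> lets one greedy rule serve both problems: it is constantly 1
  for \<open>G\<close> and the storage indicator for the final problems.\<close>

primrec greedy :: "('a \<Rightarrow> real) \<Rightarrow> ('a \<Rightarrow> real) \<Rightarrow> 'a list \<Rightarrow> real \<Rightarrow> 'a \<Rightarrow> real" where
  "greedy n c [] b = (\<lambda>_. 0)"
| "greedy n c (a # l) b =
     (let v = min (min (b / n a) 1) (c a) in (greedy n c l (b - v * n a))(a := v))"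

lemma sum_greedy_Cons:
  fixes h :: "'a \<Rightarrow> real"
  assumes "distinct (a # l)"
  shows "(\<Sum>x \<in> set (a # l). greedy n c (a # l) b x * h x) =
    (let v = min (min (b / n a) 1) (c a) in v * h a + (\<Sum>x \<in> set l. greedy n c l (b - v * n a) x * h x))"
proof -
  define v where "v = min (min (b / n a) 1) (c a)"
  have "(\<Sum>x \<in> set l. greedy n c (a # l) b x * h x) =
      (\<Sum>x \<in> set l. greedy n c l (b - v * n a) x * h x)"
    using assms by (intro sum.cong) (auto simp: Let_def v_def)
  moreover have "greedy n c (a # l) b a = v"
    by (simp add: Let_def v_def)
  ultimately show ?thesis
    using assms by (simp add: Let_def v_def[symmetric] del: greedy.simps)
qed

lemma greedy_budget:
  fixes v b n c :: real
  assumes "n > 0" "b \<ge> 0" "c \<ge> 0" "v = min (min (b / n) 1) c"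
  shows "0 \<le> v" "v \<le> 1" "v \<le> c" "v * n \<le> b"
proof -
  have "v \<le> b / n" by (simp add: assms(4))
  then show "v * n \<le> b" using assms(1) by (simp add: pos_le_divide_eq)
qed (use assms in auto)

lemma greedy_feasible:
  assumes "distinct l" "b \<ge> 0" "\<And>a. a \<in> set l \<Longrightarrow> n a > 0" "\<And>a. a \<in> set l \<Longrightarrow> c a \<ge> 0"
  shows "(\<forall>a \<in> set l. 0 \<le> greedy n c l b a \<and> greedy n c l b a \<le> 1 \<and> greedy n c l b a \<le> c a) \<and>
    (\<Sum>a \<in> set l. greedy n c l b a * n a) \<le> b"
  using assms
proof (induction l arbitrary: b)
  case (Cons a l)
  define v where "v = min (min (b / n a) 1) (c a)"
  note v = greedy_budget[OF _ _ _ v_def]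
  have "(\<forall>x \<in> set l. 0 \<le> greedy n c l (b - v * n a) x \<and> greedy n c l (b - v * n a) x \<le> 1 \<and>
      greedy n c l (b - v * n a) x \<le> c x) \<and>
    (\<Sum>x \<in> set l. greedy n c l (b - v * n a) x * n x) \<le> b - v * n a"
    using Cons.prems v(4) by (intro Cons.IH) auto
  then show ?case
    using Cons.prems v(1-3) unfolding sum_greedy_Cons[OF Cons.prems(1)] v_def[symmetric] Let_def
    by (auto simp: Let_def v_def[symmetric])
qed simp

text \<open>The slack \<open>d\<close>, priced at the best ratio \<open>\<rho>\<close>, makes the induction go through: exchanging a part
  of the first item against later items moves budget into the slack.\<close>

lemma greedy_upper:
  assumes "distinct l" "b \<ge> 0" "d \<ge> 0" "\<And>a. a \<in> set l \<Longrightarrow> n a > 0" "\<And>a. a \<in> set l \<Longrightarrow> c a \<ge> 0"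
    "\<And>a. a \<in> set l \<Longrightarrow> 0 \<le> y a \<and> y a \<le> 1 \<and> y a \<le> c a"
    "(\<Sum>a \<in> set l. y a * n a) \<le> b + d"
    "sorted_wrt (\<lambda>a a'. w a / n a \<ge> w a' / n a') l"
    "\<And>a. a \<in> set l \<Longrightarrow> w a / n a \<le> \<rho>" "\<rho> \<ge> 0" "\<And>a. a \<in> set l \<Longrightarrow> w a \<ge> 0"
  shows "(\<Sum>a \<in> set l. y a * w a) \<le> (\<Sum>a \<in> set l. greedy n c l b a * w a) + \<rho> * d"
  using assms
proof (induction l arbitrary: b d \<rho>)
  case (Cons a l)
  define v where "v = min (min (b / n a) 1) (c a)"
  have n: "n a > 0" and w: "w a \<ge> 0" using Cons.prems by auto
  note v = greedy_budget[OF n Cons.prems(2) _ v_def]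
  have c: "c a \<ge> 0" using Cons.prems by auto
  have y: "(\<Sum>x \<in> set l. y x * n x) \<le> (b - v * n a) + (d + (v - y a) * n a)"
    using Cons.prems by (simp add: algebra_simps)
  have y0: "0 \<le> (\<Sum>x \<in> set l. y x * n x)"
    using Cons.prems by (intro sum_nonneg mult_nonneg_nonneg) (auto intro: less_imp_le)
  have ya: "y a \<le> 1" "y a \<le> c a" using Cons.prems(6)[of a] by auto
  \<comment> \<open>If \<open>y\<close> takes more of the first item than the greedy rule, then
    neither 1 nor the cap limited \<open>v\<close>, so the budget did and nothing is left of it. The
    load of the later items, which is nonnegative, is then at most the new slack.\<close>
  have slack: "0 \<le> d + (v - y a) * n a"
  proof (cases "y a \<le> v")
    case True then show ?thesis using n Cons.prems(3) by simp
  next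
    case False
    then have "v = b / n a" using ya by (auto simp: v_def min_def split: if_splits)
    then have "b - v * n a = 0" using n by simp
    then show ?thesis using y y0 by simp
  qed
  \<comment> \<open>The induction hypothesis is used with the new slack priced at the ratio of the
    first item, which dominates all later ratios by sortedness. The part
    \<open>(v - y a) * n a\<close> of the slack is then worth exactly the difference in value at the
    first item.\<close>
  have "(\<Sum>x \<in> set l. y x * w x) \<le> (\<Sum>x \<in> set l. greedy n c l (b - v * n a) x * w x)
      + w a / n a * (d + (v - y a) * n a)"
    using Cons.prems v(4)[OF c] y slack divide_nonneg_pos[OF w n] by (intro Cons.IH) auto
  moreover have "w a / n a * (d + (v - y a) * n a) = w a / n a * d + (v - y a) * w a"
    using n by (simp add: field_simps)
  moreover have "w a / n a * d \<le> \<rho> * d"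
    using Cons.prems by (intro mult_right_mono) auto
  ultimately show ?case
    unfolding sum_greedy_Cons[OF Cons.prems(1)] Let_def v_def[symmetric]
    using Cons.prems(1) by (simp add: algebra_simps)
qed simp

lemma greedy_optimal:
  assumes "distinct l" "b \<ge> 0" "\<And>a. a \<in> set l \<Longrightarrow> n a > 0" "\<And>a. a \<in> set l \<Longrightarrow> c a \<ge> 0"
    "\<And>a. a \<in> set l \<Longrightarrow> 0 \<le> y a \<and> y a \<le> 1 \<and> y a \<le> c a"
    "(\<Sum>a \<in> set l. y a * n a) \<le> b"
    "sorted_wrt (\<lambda>a a'. w a / n a \<ge> w a' / n a') l" "\<And>a. a \<in> set l \<Longrightarrow> w a \<ge> 0"
  shows "(\<Sum>a \<in> set l. y a * w a) \<le> (\<Sum>a \<in> set l. greedy n c l b a * w a)"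
proof -
  have nonneg: "0 \<le> w a / n a" if "a \<in> set l" for a
    using that assms(3,8) by (intro divide_nonneg_pos)
  \<comment> \<open>The price multiplies slack 0, so any common bound of the ratios will do; their
    sum is one that also exists for the empty list.\<close>
  have "w a / n a \<le> (\<Sum>a \<in> set l. w a / n a)" if "a \<in> set l" for a
    using that nonneg by (intro member_le_sum) auto
  moreover have "0 \<le> (\<Sum>a \<in> set l. w a / n a)"
    using nonneg by (rule sum_nonneg)
  ultimately show ?thesis
    using greedy_upper[of l b 0 n c y w "\<Sum>a \<in> set l. w a / n a"] assms by auto
qed


section \<open>Values of the single-user problems\<close>

lemma Ne_pos:
  assumes "valid_network I" "i < n_users I" "j < n_cells I" "k < n_views I"
  shows "Ne I i j k > 0"
  using assms unfolding Ne_def valid_network_def by simp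

lemma Nb_pos:
  assumes "valid_network I" "i < n_users I" "j < n_cells I"
  shows "Nb I i j > 0"
  using assms unfolding Nb_def valid_network_def by simp

lemma stored_cases:
  assumes "valid_network I" "i < n_users I" "j < n_cells I" "k < n_views I"
  shows "stored I i j k = 0 \<or> stored I i j k = 1"
  using assms unfolding valid_network_def by simp

abbreviation demand :: "network \<Rightarrow> nat \<Rightarrow> nat \<times> nat \<Rightarrow> real" where
  "demand I j \<equiv> \<lambda>(i, k). Ne I i j k"

abbreviation weight :: "network \<Rightarrow> nat \<Rightarrow> nat \<times> nat \<Rightarrow> real" where
  "weight I j \<equiv> \<lambda>(i, k). stored I i j k"

lemma view_list_sorted:
  "view_list I j A l \<Longrightarrow>
    sorted_wrt (\<lambda>p q. weight I j p / demand I j p \<ge> weight I j q / demand I j q) l"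
  by (auto simp: view_list_def sorted_map split_beta)

lemma view_list_pos:
  assumes "valid_network I" "j < n_cells I" "view_list I j A l" "p \<in> set l"
  shows "demand I j p > 0" "weight I j p = 0 \<or> weight I j p = 1"
proof -
  obtain i k where p: "p = (i, k)" by (cases p)
  with assms have ik: "i < n_users I" "k < n_views I" by (auto simp: view_list_def)
  show "demand I j p > 0" using Ne_pos[OF assms(1) ik(1) assms(2) ik(2)] by (simp add: p)
  show "weight I j p = 0 \<or> weight I j p = 1"
    using stored_cases[OF assms(1) ik(1) assms(2) ik(2)] by (simp add: p)
qed

lemma sum_view_list:
  fixes f :: "nat \<times> nat \<Rightarrow> real"
  shows "view_list I j A l \<Longrightarrow> (\<Sum>p \<in> set l. f p) = (\<Sum>i \<in> A. \<Sum>k < n_views I. f (i, k))"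
  by (simp add: view_list_def sum.cartesian_product)

text \<open>The greedy filling is itself feasible, and by \<open>greedy_optimal\<close> it bounds
  every feasible choice, so the supremum is attained. The user in each pair is constant, so a choice
  \<open>y\<close> on views is read as a function of the second component.\<close>

lemma G_greedy:
  assumes I: "valid_network I" "j < n_cells I" and l: "view_list I j {i} l" and b: "b \<ge> 0"
  shows "G I i j b = ereal (\<Sum>p \<in> set l. greedy (demand I j) (\<lambda>_. 1) l b p * weight I j p)"
    (is "_ = ereal (\<Sum>p \<in> set l. ?g p * _)")
proof -
  note pos = view_list_pos[OF I l]
  have d: "distinct l" and set: "set l = {i} \<times> {..<n_views I}"
    using l by (auto simp: view_list_def)
  have feas: "(\<forall>p \<in> set l. 0 \<le> ?g p \<and> ?g p \<le> 1 \<and> ?g p \<le> 1) \<and>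
      (\<Sum>p \<in> set l. ?g p * demand I j p) \<le> b"
    by (rule greedy_feasible[OF d b]) (use pos(1) in simp_all)
  have sum: "(\<Sum>p \<in> set l. f p) = (\<Sum>k < n_views I. f (i, k))" for f :: "nat \<times> nat \<Rightarrow> real"
    unfolding sum_view_list[OF l] by simp
  show ?thesis
    unfolding G_def
  proof (intro antisym SUP_least)
    fix y assume y: "y \<in> G_feasible I i j b"
    have "(\<Sum>p \<in> set l. y (snd p) * weight I j p) \<le> (\<Sum>p \<in> set l. ?g p * weight I j p)"
    proof (rule greedy_optimal[OF d b, where n = "demand I j" and w = "weight I j"
          and y = "\<lambda>p. y (snd p)" and c = "\<lambda>_. 1"])
      show "0 \<le> y (snd p) \<and> y (snd p) \<le> 1 \<and> y (snd p) \<le> 1" if "p \<in> set l" for p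
      proof -
        have "snd p < n_views I" using that unfolding set by auto
        then show ?thesis using y unfolding G_feasible_def by blast
      qed
      show "(\<Sum>p \<in> set l. y (snd p) * demand I j p) \<le> b"
        using y by (simp add: G_feasible_def sum)
      show "weight I j p \<ge> 0" if "p \<in> set l" for p
        using pos(2)[OF that] by linarith
    qed (use pos(1) view_list_sorted[OF l] in simp_all)
    then show "ereal (\<Sum>k < n_views I. y k * stored I i j k) \<le>
        ereal (\<Sum>p \<in> set l. ?g p * weight I j p)"
      by (simp add: sum)
  next
    have "(\<lambda>k. ?g (i, k)) \<in> G_feasible I i j b"
      using feas unfolding G_feasible_def sum unfolding set by simp
    then have "ereal (\<Sum>k < n_views I. ?g (i, k) * stored I i j k) \<le>
        (SUP y \<in> G_feasible I i j b. ereal (\<Sum>k < n_views I. y k * stored I i j k))"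
      by (rule SUP_upper)
    then show "ereal (\<Sum>p \<in> set l. ?g p * weight I j p) \<le>
        (SUP y \<in> G_feasible I i j b. ereal (\<Sum>k < n_views I. y k * stored I i j k))"
      unfolding sum by simp
  qed
qed

text \<open>Demands are positive, so no load is negative and the supremum ranges over the empty set,
  where it is the bottom element of \<open>ereal\<close>.\<close>

lemma G_negative:
  assumes "valid_network I" "i < n_users I" "j < n_cells I" "b < 0"
  shows "G I i j b = -\<infinity>"
proof -
  have "y \<notin> G_feasible I i j b" for y
  proof
    assume y: "y \<in> G_feasible I i j b"
    have "0 \<le> (\<Sum>k < n_views I. y k * Ne I i j k)"
      using y Ne_pos[OF assms(1-3)]
      by (intro sum_nonneg mult_nonneg_nonneg) (auto simp: G_feasible_def intro: less_imp_le)
    with y assms(4) show False by (simp add: G_feasible_def)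
  qed
  then have "G_feasible I i j b = {}" by blast
  then show ?thesis by (simp add: G_def bot_ereal_def)
qed

section \<open>Evaluating \<open>\<Delta>Q\<close> by the machine\<close>

definition dq_cost :: "network \<Rightarrow> nat" where
  "dq_cost I = insert_views_cost I + n_users I * n_views I * (rate_cost I + 11) + rate_cost I + 8"

abbreviation gain_step ::
    "network \<Rightarrow> nat \<Rightarrow> nat \<times> nat \<Rightarrow> real \<times> real \<Rightarrow> (real \<times> real) comp" where
  "gain_step I j \<equiv> \<lambda>(i, k) (t, b).
     bind_c (ne_c I i j k) (\<lambda>n.
     bind_c (div_c b n) (\<lambda>v.
     bind_c (min_c v 1) (\<lambda>v.
     bind_c (load_c (stored I i j k)) (\<lambda>w.
     bind_c (mul_c v w) (\<lambda>g.
     bind_c (add_c t g) (\<lambda>t.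
     bind_c (mul_c v n) (\<lambda>u.
     bind_c (sub_c b u) (\<lambda>b.
     ret (t, b)))))))))"

text \<open>Proved by induction on the list rather than with an invariant on prefixes, because
  \<open>greedy\<close> recurses on the remaining items with the remaining budget. The starting
  value \<open>t\<close> is general since the machine adds the gains to the penalty term.\<close>

lemma runs_dq_loop:
  assumes "distinct l"
  shows "runs (for_c l (gain_step I j) (t, b))
    (length l * (rate_cost I + 11) + 1)
    (\<lambda>(t', b'). t' = t + (\<Sum>p \<in> set l. greedy (demand I j) (\<lambda>_. 1) l b p * weight I j p))"
  using assms
proof (induction l arbitrary: t b)
  case Nil
  show ?case by (simp add: runs_def op_c_def)
next
  case (Cons p l)
  obtain i k where p: "p = (i, k)" by (cases p)
  define v where "v = min (b / Ne I i j k) 1"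
  have IH: "runs (for_c l (gain_step I j) (t + v * stored I i j k, b - v * Ne I i j k))
    (length l * (rate_cost I + 11) + 1)
    (\<lambda>(t', b'). t' = t + (\<Sum>q \<in> set (p # l). greedy (demand I j) (\<lambda>_. 1) (p # l) b q * weight I j q))"
    using Cons.IH[of "t + v * stored I i j k" "b - v * Ne I i j k"] Cons.prems
    unfolding sum_greedy_Cons[OF Cons.prems] by (simp add: p v_def Let_def add.assoc)
  show ?case
    unfolding for_c.simps
    apply (rule runs_le)
     apply (rule runs_bind_op)
     apply (rule runs_bind_eq[where a = "(t + v * stored I i j k, b - v * Ne I i j k)"])
      apply (simp only: p prod.case op_defs)
      apply (rule runs_bind_eq[OF runs_ne] runs_bind_op runs_ret)+
      apply (simp add: v_def)
     apply (rule IH)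
    by simp
qed

lemma runs_dq:
  assumes "valid_network I" "i < n_users I" "j < n_cells I"
  shows "runs (dq_c I T nbar i j b) (dq_cost I) (\<lambda>q. q = \<Delta>Q I T nbar i j b)"
proof -
  have loop: "runs (for_c l (gain_step I j) (min (nbar - Nb I i j) 0 * T, b))
    (n_users I * n_views I * (rate_cost I + 11) + 1)
    (\<lambda>(t, b'). ereal t = \<Delta>Q I T nbar i j b)"
    if l: "view_list I j {i} l" and b: "\<not> b < 0" for l
  proof (rule runs_mono[OF runs_dq_loop])
    show "distinct l" using l by (simp add: view_list_def)
    show "length l * (rate_cost I + 11) + 1 \<le> n_users I * n_views I * (rate_cost I + 11) + 1"
      by (intro add_le_mono1 mult_le_mono1 view_list_length[OF l])
  qed (use b G_greedy[OF assms(1,3) l] in \<open>auto simp: \<Delta>Q_def\<close>)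
  show ?thesis
    unfolding dq_c_def
    apply (rule runs_le)
     apply (rule runs_bind_eq[OF runs_nb])
     apply (unfold sub_c_def[of nbar] min_c_def[of _ 0] mul_c_def[of _ T] less_c_def)
     apply (rule runs_bind_op)+
     apply (rule runs_if)
      apply (rule runs_ret)
    using G_negative[OF assms] apply (simp add: \<Delta>Q_def)
     apply (rule runs_bind[OF runs_insert_views[OF view_list_empty assms(2)]])
      apply simp
     apply (rule runs_bind_pair[OF loop])
       apply assumption
      apply assumption
     apply (rule runs_ret)
     apply simp
    apply (simp add: dq_cost_def)
    done
qed


section \<open>Selection of the best pair\<close>

text \<open>The comparison is lexicographic in value and SINR, as in \<open>best_pair\<close>. A
  candidate carries both numbers, and \<open>None\<close> stands for an empty set of examined
  pairs.\<close>

definition best_among :: "network \<Rightarrow> (nat \<Rightarrow> nat \<Rightarrow> ereal) \<Rightarrow> (nat \<times> nat) set \<Rightarrow> candidate option \<Rightarrow> bool"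
  where "best_among I D P best \<longleftrightarrow> (case best of None \<Rightarrow> P = {}
    | Some (i, j, q, s) \<Rightarrow> (i, j) \<in> P \<and> q = D i j \<and> s = sinr I i j \<and>
        (\<forall>(i', j') \<in> P. D i' j' \<le> q \<and> (D i' j' = q \<longrightarrow> sinr I i' j' \<le> s)))"

text \<open>The lexicographic order is linear and transitive, so comparing the new pair with the
  current best alone is enough. At most three comparisons are made.\<close>

lemma runs_better:
  assumes "best_among I D P best"
  shows "runs (bind_c (better_c (D i j) (sinr I i j) best)
      (\<lambda>better. ret (if better then Some (i, j, D i j, sinr I i j) else best))) 3
    (best_among I D (insert (i, j) P))"
proof (cases best)
  case None
  then show ?thesis
    using assms by (simp add: runs_def better_c_def op_c_def bind_c_def ret_def best_among_def)
next
  case (Some c)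
  obtain i0 j0 q0 s0 where c: "c = (i0, j0, q0, s0)" by (cases c)
  have P: "(i0, j0) \<in> P" "q0 = D i0 j0" "s0 = sinr I i0 j0"
    and best: "\<And>i' j'. (i', j') \<in> P \<Longrightarrow> D i' j' \<le> q0"
      "\<And>i' j'. (i', j') \<in> P \<Longrightarrow> D i' j' = q0 \<Longrightarrow> sinr I i' j' \<le> s0"
    using assms by (auto simp: best_among_def Some c)
  consider "q0 < D i j" | "q0 = D i j" "s0 < sinr I i j" | "q0 = D i j" "sinr I i j \<le> s0"
    | "D i j < q0" by fastforce
  then show ?thesis
  proof cases
    case 1
    then have "best_among I D (insert (i, j) P) (Some (i, j, D i j, sinr I i j))"
      using best by (fastforce simp: best_among_def)
    with 1 show ?thesis
      by (simp add: runs_def better_c_def op_defs op_c_def bind_c_def ret_def Some c)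
  next
    case 2
    then have "best_among I D (insert (i, j) P) (Some (i, j, D i j, sinr I i j))"
      using best by (fastforce simp: best_among_def)
    with 2 show ?thesis
      by (simp add: runs_def better_c_def op_defs op_c_def bind_c_def ret_def Some c)
  next
    case 3
    then have "best_among I D (insert (i, j) P) (Some c)"
      using best P by (auto simp: best_among_def c)
    with 3 show ?thesis
      by (simp add: runs_def better_c_def op_defs op_c_def bind_c_def ret_def Some c)
  next
    case 4
    then have "best_among I D (insert (i, j) P) (Some c)"
      using best P by (auto simp: best_among_def c)
    moreover have "\<not> q0 < D i j" "q0 \<noteq> D i j" using 4 by auto
    ultimately show ?thesis
      by (simp add: runs_def better_c_def op_defs op_c_def bind_c_def ret_def Some c)
  qed
qed

definition select_cost :: "network \<Rightarrow> nat" where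
  "select_cost I = n_users I * (n_cells I * (dq_cost I + sinr_cost I + 5) + 3) + 1"

abbreviation select_step ::
    "network \<Rightarrow> real \<Rightarrow> real \<Rightarrow> (nat \<Rightarrow> real) \<Rightarrow> nat \<Rightarrow> nat \<Rightarrow> candidate option \<Rightarrow>
     candidate option comp" where
  "select_step I T nbar b i \<equiv> \<lambda>j best.
     bind_c (load_c (b j)) (\<lambda>bj.
     bind_c (dq_c I T nbar i j bj) (\<lambda>q.
     bind_c (sinr_c I i j) (\<lambda>s.
     bind_c (better_c q s best) (\<lambda>better.
     ret (if better then Some (i, j, q, s) else best)))))"

lemma runs_select:
  assumes I: "valid_network I"
  shows "runs (select_c I T nbar b assigned) (select_cost I)
    (best_among I (\<lambda>i j. \<Delta>Q I T nbar i j (b j)) ({i. i < n_users I \<and> \<not> assigned i} \<times> {..<n_cells I}))"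
proof -
  let ?D = "\<lambda>i j. \<Delta>Q I T nbar i j (b j)"
  let ?P = "\<lambda>m. {i. i < m \<and> \<not> assigned i} \<times> {..<n_cells I}"
  have inner: "runs (for_c [0..<n_cells I] (select_step I T nbar b i) best)
      ((n_cells I - 0) * ((1 + (dq_cost I + (sinr_cost I + 3))) + 1) + 1)
      (best_among I ?D (?P i \<union> {i} \<times> {..<n_cells I}))"
    if i: "i < n_users I" and best: "best_among I ?D (?P i) best" for i best
  proof (rule runs_for_upt[where P = "\<lambda>m. best_among I ?D (?P i \<union> {i} \<times> {..<m})"])
    fix j best assume j: "j < n_cells I" and best: "best_among I ?D (?P i \<union> {i} \<times> {..<j}) best"
    have "?P i \<union> {i} \<times> {..<Suc j} = insert (i, j) (?P i \<union> {i} \<times> {..<j})" by auto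
    then show "runs (bind_c (load_c (b j)) (\<lambda>bj.
      bind_c (dq_c I T nbar i j bj) (\<lambda>q. bind_c (sinr_c I i j) (\<lambda>s.
      bind_c (better_c q s best) (\<lambda>better. ret (if better then Some (i, j, q, s) else best))))))
      (1 + (dq_cost I + (sinr_cost I + 3)))
      (best_among I ?D (?P i \<union> {i} \<times> {..<Suc j}))"
      unfolding load_c_def
      by (simp only:) (rule runs_bind_op runs_bind_eq[OF runs_dq[OF I i j]]
          runs_bind_eq[OF runs_sinr] runs_better[OF best])+
  qed (use best in auto)
  have "runs (select_c I T nbar b assigned)
    ((n_users I - 0) * ((n_cells I * (dq_cost I + sinr_cost I + 5) + 2) + 1) + 1)
    (best_among I ?D (?P (n_users I)))"
    unfolding select_c_def
  proof (rule runs_for_upt[where P = "\<lambda>m. best_among I ?D (?P m)"])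
    fix i best assume i: "i < n_users I" and best: "best_among I ?D (?P i) best"
    have *: "assigned i \<Longrightarrow> ?P (Suc i) = ?P i"
      "\<not> assigned i \<Longrightarrow> ?P (Suc i) = ?P i \<union> {i} \<times> {..<n_cells I}"
      by (auto simp: less_Suc_eq)
    show "runs (bind_c (load_c (assigned i)) (\<lambda>a. if a then ret best
      else for_c [0..<n_cells I] (select_step I T nbar b i) best))
      (n_cells I * (dq_cost I + sinr_cost I + 5) + 2) (best_among I ?D (?P (Suc i)))"
      apply (rule runs_le)
       apply (subst load_c_def)
       apply (rule runs_bind_op)
       apply (rule runs_if)
        apply (simp only: *)
        apply (rule runs_ret)
        apply (rule best)
       apply (subst *(2), assumption)
       apply (rule inner[OF i best])
      apply (simp add: algebra_simps)
      done
  qed (auto simp: best_among_def)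
  then show ?thesis by (rule runs_le) (simp add: select_cost_def algebra_simps)
qed


section \<open>The main loop\<close>

lemma fill_fst_other: "p \<notin> (\<lambda>k. (i, j, k)) ` set ks \<Longrightarrow> fst (fill I i j ks y b) p = y p"
  by (induction ks arbitrary: y b) (auto simp: Let_def)

text \<open>The machine sorts pairs while the specification orders views. For a single user the
  second projection is injective on the list, so the two descriptions translate into each
  other.\<close>

lemma view_order_view_list:
  assumes l: "view_list I j {i} l"
  shows "view_order I i j (map snd l)" and "l = map (Pair i) (map snd l)"
proof -
  have set: "set l = {i} \<times> {..<n_views I}" and d: "distinct l"
    using l by (auto simp: view_list_def)
  have "map (Pair i \<circ> snd) l = l"
    by (rule map_idI) (unfold set, auto)
  then show l': "l = map (Pair i) (map snd l)"
    by (simp add: comp_def)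
  have "inj_on snd (set l)"
    unfolding set by (simp add: inj_on_def)
  then have "distinct (map snd l)"
    using d by (simp add: distinct_map)
  moreover have "set (map snd l) = {..<n_views I}"
    unfolding set_map set by simp
  moreover have "sorted_wrt (\<lambda>p q. weight I j p / demand I j p \<ge> weight I j q / demand I j q)
      (map (Pair i) (map snd l))"
    using view_list_sorted[OF l] by (subst (asm) l')
  then have "sorted_wrt (\<lambda>k k'. stored I i j k / Ne I i j k \<ge> stored I i j k' / Ne I i j k') (map snd l)"
    by (subst (asm) sorted_wrt_map) simp
  ultimately show "view_order I i j (map snd l)"
    unfolding view_order_def by blast
qed

abbreviation fill_step ::
    "network \<Rightarrow> nat \<Rightarrow> nat \<times> nat \<Rightarrow> delivery \<times> real \<Rightarrow> (delivery \<times> real) comp" where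
  "fill_step I j \<equiv> \<lambda>(i, k) (y, b).
     bind_c (ne_c I i j k) (\<lambda>n.
     bind_c (div_c b n) (\<lambda>v.
     bind_c (min_c v 1) (\<lambda>v.
     bind_c (store_c y (i, j, k) v) (\<lambda>y.
     bind_c (mul_c v n) (\<lambda>u.
     bind_c (sub_c b u) (\<lambda>b.
     ret (y, b)))))))"

text \<open>The loop performs the same arithmetic as \<open>fill\<close>, so the results are equal
  for every real budget, negative ones included.\<close>

lemma runs_fill:
  "runs (for_c (map (Pair i) ks) (fill_step I j) (y, bj))
    (length ks * (rate_cost I + 9) + 1) (\<lambda>s. s = fill I i j ks y bj)"
proof (induction ks arbitrary: y bj)
  case Nil
  show ?case by (simp add: runs_def op_c_def)
next
  case (Cons k ks)
  define v where "v = min (bj / Ne I i j k) 1"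
  have fill: "fill I i j (k # ks) y bj = fill I i j ks (y((i, j, k) := v)) (bj - v * Ne I i j k)"
    by (simp add: v_def Let_def)
  show ?case
    unfolding for_c.simps fill list.map
    apply (rule runs_le)
     apply (rule runs_bind_op)
     apply (rule runs_bind_eq[where a = "(y((i, j, k) := v), bj - v * Ne I i j k)"])
      apply (simp only: prod.case op_defs)
      apply (rule runs_bind_eq[OF runs_ne] runs_bind_op runs_ret)+
      apply (simp add: v_def)
     apply (rule Cons.IH)
    by simp
qed

lemma elva_iter_steps:
  assumes "(elva_iter I T nbar)\<^sup>*\<^sup>* s (x, y, b, A)" "best_pair I T nbar A b i j"
    "view_order I i j ks" "fill I i j ks y (b j) = (y', bj)"
  shows "(elva_iter I T nbar)\<^sup>*\<^sup>* s (x((i, j) := 1), y', b(j := bj), insert i A)"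
proof -
  have "elva_iter I T nbar (x, y, b, A) (x((i, j) := 1), y', b(j := bj), insert i A)"
    using assms(2-4) by (rule elva_iter.intros)
  with assms(1) show ?thesis by (rule rtranclp.rtrancl_into_rtrancl)
qed

abbreviation assign_c :: "network \<Rightarrow> (nat \<Rightarrow> real) \<Rightarrow> assoc \<Rightarrow> delivery \<Rightarrow> (nat \<Rightarrow> bool) \<Rightarrow>
    nat \<Rightarrow> nat \<Rightarrow> machine_state comp" where
  "assign_c I b x y assigned i j \<equiv>
     bind_c (store_c x (i, j) 1) (\<lambda>x.
     bind_c (insert_views_c I j i []) (\<lambda>l.
     bind_c (load_c (b j)) (\<lambda>bj.
     bind_c (for_c l (fill_step I j) (y, bj)) (\<lambda>(y, bj).
     bind_c (store_c b j bj) (\<lambda>b.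
     bind_c (store_c assigned i True) (\<lambda>assigned.
     ret (x, y, b, assigned)))))))"

definition round_cost :: "network \<Rightarrow> nat" where
  "round_cost I = select_cost I + insert_views_cost I + n_users I * n_views I * (rate_cost I + 9) + 5"

text \<open>The index counts the unassigned users and drives \<open>runs_while\<close>; the middle
  clause is the simulation of the abstract iteration. The last clause is what the final
  recomputation relies on for users outside a cell.\<close>

definition loop_inv :: "network \<Rightarrow> real \<Rightarrow> real \<Rightarrow> (nat \<Rightarrow> real) \<Rightarrow> nat \<Rightarrow> machine_state \<Rightarrow> bool" where
  "loop_inv I T nbar b0 n = (\<lambda>(x, y, b, assigned).
     n = card {i. i < n_users I \<and> \<not> assigned i} \<and>
     (elva_iter I T nbar)\<^sup>*\<^sup>* ((\<lambda>_. 0), (\<lambda>_. 0), b0, {}) (x, y, b, {i. i < n_users I \<and> assigned i}) \<and>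
     (\<forall>i j k. x (i, j) \<noteq> 1 \<longrightarrow> y (i, j, k) = 0))"

text \<open>An unassigned user and a cell exist, so the selection returns a pair. That pair is a
  legal choice of \<open>elva_iter\<close>, and assigning its user lowers the count by one.\<close>

lemma runs_round:
  assumes I: "valid_network I" and inv: "loop_inv I T nbar b0 (Suc n) s"
  shows "runs (round_c I T nbar s) (round_cost I) (loop_inv I T nbar b0 n)"
proof -
  obtain x y b assigned where s: "s = (x, y, b, assigned)" by (cases s)
  let ?A = "{i. i < n_users I \<and> assigned i}" and ?U = "{i. i < n_users I \<and> \<not> assigned i}"
  have card: "card ?U = Suc n" and steps:
    "(elva_iter I T nbar)\<^sup>*\<^sup>* ((\<lambda>_. 0), (\<lambda>_. 0), b0, {}) (x, y, b, ?A)"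
    and zero: "\<And>i j k. x (i, j) \<noteq> 1 \<Longrightarrow> y (i, j, k) = 0"
    using inv by (auto simp: loop_inv_def s)
  have "?U \<noteq> {}"
  proof
    assume "?U = {}"
    from card[unfolded this] show False by simp
  qed
  then obtain i where "i \<in> ?U" by blast
  moreover have "0 < n_cells I" using I by (simp add: valid_network_def)
  ultimately have ne: "(i, 0) \<in> ?U \<times> {..<n_cells I}" by simp
  have body: "runs (assign_c I b x y assigned i j)
      (insert_views_cost I + n_users I * n_views I * (rate_cost I + 9) + 5)
      (loop_inv I T nbar b0 n)"
    if best: "best_pair I T nbar ?A b i j" for i j
  proof -
    have i: "i < n_users I" "\<not> assigned i" using best by (auto simp: best_pair_def)
    have fill: "runs (for_c l (fill_step I j) (y, b j))
     (n_users I * n_views I * (rate_cost I + 9) + 1)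
     (\<lambda>(y', bj). loop_inv I T nbar b0 n (x((i, j) := 1), y', b(j := bj), assigned(i := True)))"
      if l: "view_list I j {i} l" for l
    proof (subst view_order_view_list(2)[OF l], rule runs_mono[OF runs_fill])
      show "length (map snd l) * (rate_cost I + 9) + 1 \<le> n_users I * n_views I * (rate_cost I + 9) + 1"
        unfolding length_map by (intro add_le_mono1 mult_le_mono1 view_list_length[OF l])
      fix s' assume s': "s' = fill I i j (map snd l) y (b j)"
      obtain y' bj where y': "s' = (y', bj)" by (cases s')
      let ?x = "x((i, j) := 1)" and ?assigned = "assigned(i := True)"
      note elva_iter_steps[OF steps best view_order_view_list(1)[OF l] trans[OF s'[symmetric] y']]
      moreover have "insert i ?A = {i'. i' < n_users I \<and> ?assigned i'}"
        using i by auto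
      ultimately have steps': "(elva_iter I T nbar)\<^sup>*\<^sup>* ((\<lambda>_. 0), (\<lambda>_. 0), b0, {})
          (?x, y', b(j := bj), {i'. i' < n_users I \<and> ?assigned i'})"
        by (simp only:)
      have "{i'. i' < n_users I \<and> \<not> ?assigned i'} = ?U - {i}" by auto
      moreover have "card (?U - {i}) = n"
        using card i by (subst card_Diff_singleton) auto
      ultimately have card': "n = card {i'. i' < n_users I \<and> \<not> ?assigned i'}"
        by (simp only:)
      \<comment> \<open>The filling writes only entries of the pair \<open>(i, j)\<close>, and there
        \<open>x\<close> has just become 1.\<close>
      have zero': "y' (i', j', k) = 0" if "?x (i', j') \<noteq> 1" for i' j' k
      proof -
        have ne: "(i', j') \<noteq> (i, j)"
          using that by (rule contrapos_nn) (simp only: fun_upd_same)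
        have "x (i', j') \<noteq> 1"
          using that unfolding fun_upd_other[OF ne] .
        note zero[OF this, of k]
        moreover have "fst (fill I i j (map snd l) y (b j)) (i', j', k) = y (i', j', k)"
          by (rule fill_fst_other) (use ne in auto)
        ultimately show ?thesis unfolding s'[symmetric] y' by simp
      qed
      show "case s' of (y', bj) \<Rightarrow>
          loop_inv I T nbar b0 n (x((i, j) := 1), y', b(j := bj), assigned(i := True))"
        unfolding y' loop_inv_def prod.case
        by (intro conjI allI impI, rule card', rule steps', erule zero')
    qed
    show ?thesis
      apply (rule runs_le)
       apply (subst (1) store_c_def)
       apply (rule runs_bind_op)
       apply (rule runs_bind[OF runs_insert_views[OF view_list_empty i(1)]])
        apply simp
       apply (subst (1) load_c_def)
       apply (rule runs_bind_op)
       apply (rule runs_bind_pair[OF fill])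
        apply assumption
       apply (unfold store_c_def)
       apply (rule runs_bind_op)+
       apply (rule runs_ret)
       apply (simp only: prod.case)
      apply simp
      done
  qed
  show ?thesis
    unfolding round_c_def s prod.case
  proof (rule runs_le[OF runs_bind[OF runs_select[OF I]]])
    fix best assume *: "best_among I (\<lambda>i j. \<Delta>Q I T nbar i j (b j)) (?U \<times> {..<n_cells I}) best"
    have "best \<noteq> None"
    proof
      assume "best = None"
      from *[unfolded this best_among_def option.case] ne show False by (simp only: empty_iff)
    qed
    then obtain i j q r where best: "best = Some (i, j, q, r)" by (cases best) auto
    then have "best_pair I T nbar ?A b i j"
      using * by (auto simp: best_among_def best_pair_def)
    from body[OF this] show "runs (case best of None \<Rightarrow> ret (x, y, b, assigned)
      | Some (i, j, _) \<Rightarrow> assign_c I b x y assigned i j)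
      (insert_views_cost I + n_users I * n_views I * (rate_cost I + 9) + 5)
      (loop_inv I T nbar b0 n)"
      unfolding best option.case prod.case .
  qed (simp add: round_cost_def)
qed

definition test_cost :: "network \<Rightarrow> nat" where
  "test_cost I = n_users I * 2 + 1"

lemma runs_unassigned:
  assumes "loop_inv I T nbar b0 n s"
  shows "runs (unassigned_c I s) (test_cost I) (\<lambda>t. t \<longleftrightarrow> n > 0)"
proof -
  obtain x y b assigned where s: "s = (x, y, b, assigned)" by (cases s)
  have "runs (unassigned_c I s) ((n_users I - 0) * (1 + 1) + 1)
      (\<lambda>t. t \<longleftrightarrow> (\<exists>i < n_users I. \<not> assigned i))"
    unfolding unassigned_c_def s prod.case
    by (rule runs_for_upt[where P = "\<lambda>m t. t \<longleftrightarrow> (\<exists>i < m. \<not> assigned i)"])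
      (auto simp: runs_def load_c_def op_c_def bind_c_def ret_def less_Suc_eq)
  moreover have "n > 0 \<longleftrightarrow> (\<exists>i < n_users I. \<not> assigned i)"
    using assms by (auto simp: loop_inv_def s card_gt_0_iff)
  ultimately show ?thesis by (simp add: test_cost_def numeral_2_eq_2)
qed


section \<open>The final knapsack problems\<close>

text \<open>The condition imposed by \<open>elva_output\<close> on a single cell. It reads
  \<open>y\<close> only at that cell, so cells can be treated one after another.\<close>

definition cell_optimal :: "network \<Rightarrow> assoc \<Rightarrow> nat \<Rightarrow> delivery \<Rightarrow> bool" where
  "cell_optimal I x j y \<longleftrightarrow>
     (if U_feasible I j (users_of I x j) \<noteq> {}
      then U_optimal I j (users_of I x j) (\<lambda>i k. y (i, j, k))
      else (\<forall>i \<in> users_of I x j. \<forall>k < n_views I. y (i, j, k) = 0)) \<and>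
     (\<forall>i < n_users I. i \<notin> users_of I x j \<longrightarrow> (\<forall>k < n_views I. y (i, j, k) = 0))"

text \<open>Justifies a running maximum started at 0: nonnegativity is what makes the convention for
  the empty set agree with the first demand.\<close>

lemma Nb_max_insert:
  assumes "finite A" "Nb I i j \<ge> 0"
  shows "Nb_max I j (insert i A) = max (Nb_max I j A) (Nb I i j)"
  using assms by (auto simp: Nb_max_def max.commute)

lemma U_feasible_view_list:
  assumes "view_list I j A l"
  shows "y \<in> U_feasible I j A \<longleftrightarrow>
    (\<forall>(i, k) \<in> set l. 0 \<le> y i k \<and> y i k \<le> 1 \<and> y i k \<le> stored I i j k) \<and>
    (\<Sum>(i, k) \<in> set l. y i k * Ne I i j k) \<le> real (blocks I j) - Nb_max I j A"
  unfolding sum_view_list[OF assms] using assms by (auto simp: U_feasible_def view_list_def)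

lemma U_value_view_list:
  assumes "view_list I j A l"
  shows "U_value I j A y = (\<Sum>(i, k) \<in> set l. y i k * stored I i j k)"
  unfolding sum_view_list[OF assms] U_value_def by simp

text \<open>A feasible load is a sum of nonnegative terms. Together with \<open>U_greedy\<close>
  this shows that the sign test of the machine decides the case distinction of the
  specification.\<close>

lemma U_infeasible:
  assumes I: "valid_network I" "j < n_cells I" and l: "view_list I j A l"
    and b: "real (blocks I j) - Nb_max I j A < 0"
  shows "U_feasible I j A = {}"
proof -
  have "y \<notin> U_feasible I j A" for y
  proof
    assume y: "y \<in> U_feasible I j A"
    have "0 \<le> (\<Sum>(i, k) \<in> set l. y i k * Ne I i j k)"
    proof (rule sum_nonneg)
      fix p assume p: "p \<in> set l"
      obtain i k where ik: "p = (i, k)" by (cases p)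
      show "0 \<le> (case p of (i, k) \<Rightarrow> y i k * Ne I i j k)"
        using y p view_list_pos(1)[OF I l p] unfolding U_feasible_view_list[OF l] ik by auto
    qed
    with y b show False unfolding U_feasible_view_list[OF l] by linarith
  qed
  then show ?thesis by blast
qed

text \<open>Storage indicators are 0 or 1, hence nonnegative, so they can serve both as caps and as
  weights of the knapsack.\<close>

lemma U_greedy:
  assumes I: "valid_network I" "j < n_cells I" and l: "view_list I j A l"
    and b: "real (blocks I j) - Nb_max I j A \<ge> 0"
  shows "U_optimal I j A (\<lambda>i k. greedy (demand I j) (weight I j) l
    (real (blocks I j) - Nb_max I j A) (i, k))"
proof -
  note pos = view_list_pos[OF I l]
  have d: "distinct l" using l by (simp add: view_list_def)
  have w: "weight I j p \<ge> 0" if "p \<in> set l" for p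
    using pos(2)[OF that] by linarith
  define g where "g = greedy (demand I j) (weight I j) l (real (blocks I j) - Nb_max I j A)"
  have "(\<forall>p \<in> set l. 0 \<le> g p \<and> g p \<le> 1 \<and> g p \<le> weight I j p) \<and>
      (\<Sum>p \<in> set l. g p * demand I j p) \<le> real (blocks I j) - Nb_max I j A"
    unfolding g_def by (rule greedy_feasible[OF d b]) (use pos(1) w in simp_all)
  then have "(\<lambda>i k. g (i, k)) \<in> U_feasible I j A"
    unfolding U_feasible_view_list[OF l] by (simp add: split_beta)
  moreover have "U_value I j A y \<le> U_value I j A (\<lambda>i k. g (i, k))" if "y \<in> U_feasible I j A" for y
  proof -
    have "(\<Sum>p \<in> set l. y (fst p) (snd p) * weight I j p) \<le> (\<Sum>p \<in> set l. g p * weight I j p)"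
      unfolding g_def
      by (rule greedy_optimal[OF d b, where n = "demand I j" and w = "weight I j"
            and y = "\<lambda>p. y (fst p) (snd p)" and c = "weight I j"])
        (use pos(1) w that[unfolded U_feasible_view_list[OF l]] view_list_sorted[OF l]
          in \<open>simp_all add: split_beta\<close>)
    then show ?thesis unfolding U_value_view_list[OF l] by (simp add: split_beta)
  qed
  ultimately show ?thesis unfolding U_optimal_def g_def by blast
qed

abbreviation store_step ::
    "network \<Rightarrow> nat \<Rightarrow> nat \<times> nat \<Rightarrow> delivery \<times> real \<Rightarrow> (delivery \<times> real) comp" where
  "store_step I j \<equiv> \<lambda>(i, k) (y, b).
     bind_c (ne_c I i j k) (\<lambda>n.
     bind_c (div_c b n) (\<lambda>v.
     bind_c (min_c v 1) (\<lambda>v.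
     bind_c (load_c (stored I i j k)) (\<lambda>w.
     bind_c (min_c v w) (\<lambda>v.
     bind_c (store_c y (i, j, k) v) (\<lambda>y.
     bind_c (mul_c v n) (\<lambda>u.
     bind_c (sub_c b u) (\<lambda>b.
     ret (y, b)))))))))"

text \<open>Gives the final array in closed form. Distinctness guarantees that no later store
  overwrites an entry already written.\<close>

lemma runs_greedy_store:
  assumes "distinct l"
  shows "runs (for_c l (store_step I j) (y, b))
    (length l * (rate_cost I + 11) + 1)
    (\<lambda>(y', _). y' = (\<lambda>(i, j', k). if j' = j \<and> (i, k) \<in> set l
       then greedy (demand I j) (weight I j) l b (i, k) else y (i, j', k)))"
  using assms
proof (induction l arbitrary: y b)
  case Nil
  show ?case by (simp add: runs_def op_c_def)
next
  case (Cons p l)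
  obtain i k where p: "p = (i, k)" by (cases p)
  define v where "v = min (min (b / Ne I i j k) 1) (stored I i j k)"
  let ?y = "y((i, j, k) := v)" and ?b = "b - v * Ne I i j k"
  have eq: "(\<lambda>(i, j', k). if j' = j \<and> (i, k) \<in> set l
       then greedy (demand I j) (weight I j) l ?b (i, k) else ?y (i, j', k)) =
     (\<lambda>(i, j', k). if j' = j \<and> (i, k) \<in> set (p # l)
       then greedy (demand I j) (weight I j) (p # l) b (i, k) else y (i, j', k))"
    using Cons.prems by (auto simp: fun_eq_iff p Let_def v_def)
  show ?case
    unfolding for_c.simps eq[symmetric]
    apply (rule runs_le)
     apply (rule runs_bind_op)
     apply (rule runs_bind_eq[where a = "(?y, ?b)"])
      apply (simp only: p prod.case op_defs)
      apply (rule runs_bind_eq[OF runs_ne] runs_bind_op runs_ret)+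
      apply (simp add: v_def)
     apply (rule Cons.IH)
    using Cons.prems by simp_all
qed

lemma runs_clear:
  fixes y :: delivery and l :: "(nat \<times> nat) list"
  shows "runs (for_c l (\<lambda>(i, k) y. store_c y (i, j, k) 0) y) (length l * (1 + 1) + 1)
    (\<lambda>y'. y' = (\<lambda>(i, j', k). if j' = j \<and> (i, k) \<in> set l then 0 else y (i, j', k)))"
proof (rule runs_for_list[where P = "\<lambda>xs y'. y' = (\<lambda>(i, j', k).
    if j' = j \<and> (i, k) \<in> set xs then 0 else y (i, j', k))"])
  fix xs ys and p :: "nat \<times> nat" and s :: delivery
  assume s: "s = (\<lambda>(i, j', k). if j' = j \<and> (i, k) \<in> set xs then 0 else y (i, j', k))"
  obtain i k where p: "p = (i, k)" by (cases p)
  show "runs ((case p of (i, k) \<Rightarrow> \<lambda>y. store_c y (i, j, k) 0) s) 1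
      (\<lambda>y'. y' = (\<lambda>(i, j', k). if j' = j \<and> (i, k) \<in> set (xs @ [p]) then 0 else y (i, j', k)))"
    unfolding p prod.case store_c_def by (rule runs_op) (auto simp: s fun_eq_iff)
qed auto

definition recompute_cost :: "network \<Rightarrow> nat" where
  "recompute_cost I = n_users I * (insert_views_cost I + rate_cost I + 7) +
     n_users I * n_views I * (rate_cost I + 11) + 5"

text \<open>The second conjunct of the postcondition is a frame condition: other cells are
  untouched, so results for earlier cells survive and later cells still satisfy the assumption on
  zero entries.\<close>

lemma runs_recompute:
  assumes I: "valid_network I" "j < n_cells I"
    and zero: "\<And>i k. x (i, j) \<noteq> 1 \<Longrightarrow> y (i, j, k) = 0"
  shows "runs (recompute_c I x j y) (recompute_cost I)
    (\<lambda>y'. cell_optimal I x j y' \<and> (\<forall>i j' k. j' \<noteq> j \<longrightarrow> y' (i, j', k) = y (i, j', k)))"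
proof -
  let ?U = "\<lambda>m. {i. i < m \<and> x (i, j) = 1}"
  let ?P = "\<lambda>m (l, b). view_list I j (?U m) l \<and> b = Nb_max I j (?U m)"
  have loop: "runs (for_c [0..<n_users I] (\<lambda>i (l, m). bind_c (load_c (x (i, j))) (\<lambda>a.
      bind_c (eq_c a 1) (\<lambda>a. if a then bind_c (insert_views_c I j i l) (\<lambda>l.
      bind_c (nb_c I i j) (\<lambda>n. bind_c (max_c m n) (\<lambda>m. ret (l, m)))) else ret (l, m)))) ([], 0))
     ((n_users I - 0) * ((insert_views_cost I + rate_cost I + 6) + 1) + 1) (?P (n_users I))"
  proof (rule runs_for_upt[where P = ?P])
    fix i s assume i: "i < n_users I" and "?P i s"
    then obtain l m where s: "s = (l, m)" and l: "view_list I j (?U i) l" and m: "m = Nb_max I j (?U i)"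
      by (cases s) auto
    have *: "?U (Suc i) = (if x (i, j) = 1 then insert i (?U i) else ?U i)"
      by (auto simp: less_Suc_eq)
    have Nb_max: "max m (Nb I i j) = Nb_max I j (insert i (?U i))"
      unfolding m using Nb_pos[OF I(1) i I(2)] by (intro Nb_max_insert[symmetric]) auto
    show "runs ((\<lambda>(l, m). bind_c (load_c (x (i, j))) (\<lambda>a.
      bind_c (eq_c a 1) (\<lambda>a. if a then bind_c (insert_views_c I j i l) (\<lambda>l.
      bind_c (nb_c I i j) (\<lambda>n. bind_c (max_c m n) (\<lambda>m. ret (l, m)))) else ret (l, m)))) s)
      (insert_views_cost I + rate_cost I + 6) (?P (Suc i))"
      unfolding s prod.case op_defs
      apply (rule runs_le)
       apply (rule runs_bind_op)+
       apply (rule runs_if)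
        apply (rule runs_bind[OF runs_insert_views[OF l i]])
         apply simp
        apply (rule runs_bind_eq[OF runs_nb])
        apply (rule runs_bind_op)
        apply (rule runs_ret)
        apply (simp only: * Nb_max prod.case simp_thms if_True)
       apply (rule runs_ret)
       apply (simp only: * m l prod.case simp_thms if_False)
      apply simp
      done
  qed (auto simp: view_list_empty Nb_max_def)
  have users: "?U (n_users I) = users_of I x j" by (auto simp: users_of_def)
  let ?b = "real (blocks I j) - Nb_max I j (users_of I x j)"
  have outside: "i < n_users I \<Longrightarrow> i \<notin> users_of I x j \<Longrightarrow> y (i, j, k) = 0" for i k
    using zero by (auto simp: users_of_def)
  have set: "set l = users_of I x j \<times> {..<n_views I}" if "view_list I j (users_of I x j) l" for l
    using that by (simp add: view_list_def)
  have clear: "runs (for_c l (\<lambda>(i, k) y. store_c y (i, j, k) 0) y)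
      (n_users I * n_views I * (rate_cost I + 11) + 1)
      (\<lambda>y'. cell_optimal I x j y' \<and> (\<forall>i j' k. j' \<noteq> j \<longrightarrow> y' (i, j', k) = y (i, j', k)))"
    if l: "view_list I j (users_of I x j) l" and b: "?b < 0" for l
  proof (rule runs_mono[OF runs_clear])
    show "length l * (1 + 1) + 1 \<le> n_users I * n_views I * (rate_cost I + 11) + 1"
      by (intro add_le_mono1 mult_le_mono view_list_length[OF l]) simp
  qed (use U_infeasible[OF I l b] outside in \<open>auto simp: cell_optimal_def set[OF l]\<close>)
  have store: "runs (for_c l (store_step I j) (y, ?b))
      (n_users I * n_views I * (rate_cost I + 11) + 1)
      (\<lambda>(y', _). cell_optimal I x j y' \<and> (\<forall>i j' k. j' \<noteq> j \<longrightarrow> y' (i, j', k) = y (i, j', k)))"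
    if l: "view_list I j (users_of I x j) l" and b: "\<not> ?b < 0" for l
  proof (rule runs_mono[OF runs_greedy_store])
    show "distinct l" using l by (simp add: view_list_def)
    show "length l * (rate_cost I + 11) + 1 \<le> n_users I * n_views I * (rate_cost I + 11) + 1"
      by (intro add_le_mono1 mult_le_mono1 view_list_length[OF l])
    let ?g = "greedy (demand I j) (weight I j) l ?b"
    fix s :: "delivery \<times> real"
    assume s: "case s of (y', _) \<Rightarrow> y' = (\<lambda>(i, j', k). if j' = j \<and> (i, k) \<in> set l
       then ?g (i, k) else y (i, j', k))"
    obtain y' b' where s': "s = (y', b')" by (cases s)
    have y': "y' (i, j', k) = (if j' = j \<and> (i, k) \<in> set l then ?g (i, k) else y (i, j', k))"
      for i j' k using s by (simp add: s')
    have opt: "U_optimal I j (users_of I x j) (\<lambda>i k. ?g (i, k))"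
      using b by (intro U_greedy[OF I l]) simp
    \<comment> \<open>Feasibility and value read only these entries, so optimality passes from the
      greedy solution to the stored array.\<close>
    have "?g (i, k) = y' (i, j, k)" if "i \<in> users_of I x j" "k < n_views I" for i k
      using that by (simp add: y' set[OF l])
    then have "U_optimal I j (users_of I x j) (\<lambda>i k. y' (i, j, k))"
      using opt by (simp add: U_optimal_def U_feasible_def U_value_def)
    then have "cell_optimal I x j y'"
      using outside unfolding cell_optimal_def U_optimal_def by (auto simp: y' set[OF l])
    then show "case s of (y', _) \<Rightarrow> cell_optimal I x j y' \<and> (\<forall>i j' k. j' \<noteq> j \<longrightarrow> y' (i, j', k) = y (i, j', k))"
      by (simp add: s' y')
  qed
  show ?thesis
    unfolding recompute_c_def
    apply (rule runs_le)
     apply (rule runs_bind_pair[OF loop])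
     apply (simp only: prod.case users)
     apply (subst load_c_def[of "real _"])
     apply (rule runs_bind_op)
     apply (subst sub_c_def[of "real _"])
     apply (rule runs_bind_op)
     apply (subst less_c_def)
     apply (rule runs_bind_op)
     apply (rule runs_if)
      apply (rule clear)
       apply blast
      apply simp
     apply (rule runs_bind_pair[OF store])
       apply blast
      apply simp
     apply (rule runs_ret)
     apply simp
    apply (simp add: recompute_cost_def algebra_simps)
    done
qed

section \<open>The complete run of ELVA\<close>

definition elva_cost :: "network \<Rightarrow> nat" where
  "elva_cost I = n_users I * n_cells I + n_users I * n_cells I * n_views I + n_users I +
     nbar_cost I + 6 * n_cells I + n_users I * (test_cost I + round_cost I + 1) + test_cost I +
     n_cells I * recompute_cost I + 8"

lemma runs_elva:
  assumes I: "valid_network I"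
  shows "runs (elva_c I T) (elva_cost I) (\<lambda>(x, y). elva_output I T x y)"
proof -
  have pos: "n_cells I > 0" "n_users I > 0" using I by (auto simp: valid_network_def)
  have budgets: "runs (for_c [0..<n_cells I] (\<lambda>j b. bind_c (load_c (real (blocks I j))) (\<lambda>N.
      bind_c (sub_c N nbar) (\<lambda>v. store_c b j v))) (\<lambda>_. 0))
     ((n_cells I - 0) * (3 + 1) + 1) (\<lambda>b. \<forall>j < n_cells I. b j = real (blocks I j) - nbar)" for nbar
    by (rule runs_for_upt[where P = "\<lambda>m b. \<forall>j < m. b j = real (blocks I j) - nbar"])
      (auto simp: runs_def op_defs op_c_def bind_c_def less_Suc_eq)
  have init: "loop_inv I T nbar b (n_users I) (\<lambda>_. 0, \<lambda>_. 0, b, \<lambda>_. False)" for nbar b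
    by (simp add: loop_inv_def)
  have final: "runs (for_c [0..<n_cells I] (recompute_c I x) y) ((n_cells I - 0) * (recompute_cost I + 1) + 1)
     (\<lambda>y. \<forall>j < n_cells I. cell_optimal I x j y)"
    if "\<And>i j k. x (i, j) \<noteq> 1 \<Longrightarrow> y (i, j, k) = 0" for x y
  proof -
    have ext: "cell_optimal I x j y'' \<longleftrightarrow> cell_optimal I x j y'"
      if "\<And>i k. y'' (i, j, k) = y' (i, j, k)" for j y' y''
      by (simp add: cell_optimal_def that)
    \<comment> \<open>The invariant also records that cells not yet reached keep the values left by
      the main loop, where the assumption on zero entries is known.\<close>
    have "runs (for_c [0..<n_cells I] (recompute_c I x) y) ((n_cells I - 0) * (recompute_cost I + 1) + 1)
       (\<lambda>y'. (\<forall>j < n_cells I. cell_optimal I x j y') \<and>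
         (\<forall>i j k. n_cells I \<le> j \<longrightarrow> y' (i, j, k) = y (i, j, k)))"
    proof (rule runs_for_upt[where P = "\<lambda>m y'. (\<forall>j < m. cell_optimal I x j y') \<and>
         (\<forall>i j k. m \<le> j \<longrightarrow> y' (i, j, k) = y (i, j, k))"])
      fix j y' assume j: "j < n_cells I" and y': "(\<forall>j' < j. cell_optimal I x j' y') \<and>
         (\<forall>i j' k. j \<le> j' \<longrightarrow> y' (i, j', k) = y (i, j', k))"
      show "runs (recompute_c I x j y') (recompute_cost I) (\<lambda>y'. (\<forall>j' < Suc j. cell_optimal I x j' y') \<and>
         (\<forall>i j' k. Suc j \<le> j' \<longrightarrow> y' (i, j', k) = y (i, j', k)))"
      proof (rule runs_mono[OF runs_recompute[OF I j]])
        show "y' (i, j, k) = 0" if "x (i, j) \<noteq> 1" for i k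
          using y' \<open>\<And>i j k. x (i, j) \<noteq> 1 \<Longrightarrow> y (i, j, k) = 0\<close>[OF that] by simp
        fix y'' assume y'': "cell_optimal I x j y'' \<and>
          (\<forall>i j' k. j' \<noteq> j \<longrightarrow> y'' (i, j', k) = y' (i, j', k))"
        have "cell_optimal I x j' y''" if "j' < Suc j" for j'
        proof (cases "j' = j")
          case False
          then have "cell_optimal I x j' y'' \<longleftrightarrow> cell_optimal I x j' y'"
            using y'' by (intro ext) blast
          then show ?thesis using False that y' by simp
        qed (use y'' in simp)
        moreover have "y'' (i, j', k) = y (i, j', k)" if "Suc j \<le> j'" for i j' k
          using that y' y'' by simp
        ultimately show "(\<forall>j' < Suc j. cell_optimal I x j' y'') \<and>
         (\<forall>i j' k. Suc j \<le> j' \<longrightarrow> y'' (i, j', k) = y (i, j', k))" by blast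
      qed simp
    qed auto
    then show ?thesis by (rule runs_mono) auto
  qed
  have loop: "runs (while_c (unassigned_c I) (round_c I T nbar) (\<lambda>_. 0, \<lambda>_. 0, b, \<lambda>_. False))
      (n_users I * (test_cost I + round_cost I + 1) + test_cost I + 1) (loop_inv I T nbar b 0)"
    for nbar b
    using runs_unassigned runs_round[OF I] init
    by (rule runs_while[where P = "loop_inv I T nbar b"])
  have tail: "runs (bind_c (while_c (unassigned_c I) (round_c I T nbar) (\<lambda>_. 0, \<lambda>_. 0, b, \<lambda>_. False))
      (\<lambda>(x, y, b, assigned). bind_c (for_c [0..<n_cells I] (recompute_c I x) y) (\<lambda>y. ret (x, y))))
     (n_users I * (test_cost I + round_cost I + 1) + test_cost I + 1 +
       ((n_cells I - 0) * (recompute_cost I + 1) + 1 + 0))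
     (\<lambda>(x, y). elva_output I T x y)"
    if nbar: "\<exists>i0 j0. attains_max_min I i0 j0 \<and> nbar = basic_size I / rate I i0 j0"
      and b: "\<forall>j < n_cells I. b j = real (blocks I j) - nbar" for nbar b
  proof (rule runs_bind[OF loop])
    fix s assume s: "loop_inv I T nbar b 0 s"
    obtain x y1 b1 assigned where eq: "s = (x, y1, b1, assigned)" by (cases s)
    have "card {i. i < n_users I \<and> \<not> assigned i} = 0"
      and steps: "(elva_iter I T nbar)\<^sup>*\<^sup>* ((\<lambda>_. 0), (\<lambda>_. 0), b, {})
        (x, y1, b1, {i. i < n_users I \<and> assigned i})"
      and zero: "\<And>i j k. x (i, j) \<noteq> 1 \<Longrightarrow> y1 (i, j, k) = 0"
      using s by (auto simp: loop_inv_def eq)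
    then have "{i. i < n_users I \<and> assigned i} = {..<n_users I}" by auto
    note steps' = steps[unfolded this]
    have "elva_output I T x y" if "\<forall>j < n_cells I. cell_optimal I x j y" for y
      using that[unfolded cell_optimal_def] nbar b steps' unfolding elva_output_def by blast
    then have out: "(case (x, y) of (x, y) \<Rightarrow> elva_output I T x y)"
      if "\<forall>j < n_cells I. cell_optimal I x j y" for y
      using that by simp
    show "runs (case s of (x, y, b, assigned) \<Rightarrow> bind_c (for_c [0..<n_cells I] (recompute_c I x) y)
        (\<lambda>y. ret (x, y))) ((n_cells I - 0) * (recompute_cost I + 1) + 1 + 0)
      (\<lambda>(x, y). elva_output I T x y)"
      unfolding eq prod.case
      by (rule runs_bind, rule final, erule zero, rule runs_ret, erule out)
  qed
  show ?thesis
    unfolding elva_c_def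
    apply (rule runs_le)
     apply (rule runs_bind_eq[OF runs_new, OF refl])
     apply (rule runs_bind_eq[OF runs_new, OF refl])
     apply (rule runs_bind_eq[OF runs_new, OF refl])
     apply (rule runs_bind[OF runs_nbar[OF pos]])
     apply (rule runs_bind_eq[OF runs_new, OF refl])
     apply (rule runs_bind[OF budgets])
     apply (rule tail)
      apply assumption
     apply assumption
    \<comment> \<open>The six units per cell are one for allocating the budgets, four for a pass
      initializing them, and one for the final loop over cells.\<close>
    apply (simp add: elva_cost_def algebra_simps)
    done
qed


section \<open>Polynomial bounds\<close>

text \<open>With values in \<open>nat\<close>, upper bounds add and multiply directly, so sums and
  products of polynomials witness closure.\<close>

definition poly_bounded :: "(network \<Rightarrow> nat) \<Rightarrow> bool" where
  "poly_bounded f \<longleftrightarrow> (\<exists>p :: nat poly. \<forall>I. valid_network I \<longrightarrow> f I \<le> poly p (instance_size I))"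

lemma poly_bounded_const: "poly_bounded (\<lambda>_. c)"
  unfolding poly_bounded_def by (rule exI[of _ "[:c:]"]) simp

lemma poly_bounded_add:
  assumes "poly_bounded f" "poly_bounded g"
  shows "poly_bounded (\<lambda>I. f I + g I)"
proof -
  from assms obtain p q :: "nat poly" where
    "\<forall>I. valid_network I \<longrightarrow> f I \<le> poly p (instance_size I)"
    "\<forall>I. valid_network I \<longrightarrow> g I \<le> poly q (instance_size I)"
    unfolding poly_bounded_def by blast
  then show ?thesis
    unfolding poly_bounded_def by (intro exI[of _ "p + q"]) (simp add: add_mono)
qed

lemma poly_bounded_mult:
  assumes "poly_bounded f" "poly_bounded g"
  shows "poly_bounded (\<lambda>I. f I * g I)"
proof -
  from assms obtain p q :: "nat poly" where
    "\<forall>I. valid_network I \<longrightarrow> f I \<le> poly p (instance_size I)"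
    "\<forall>I. valid_network I \<longrightarrow> g I \<le> poly q (instance_size I)"
    unfolding poly_bounded_def by blast
  then show ?thesis
    unfolding poly_bounded_def by (intro exI[of _ "p * q"]) (simp add: mult_le_mono)
qed

lemma poly_bounded_instance_size:
  "(\<And>I. valid_network I \<Longrightarrow> f I \<le> instance_size I) \<Longrightarrow> poly_bounded f"
  unfolding poly_bounded_def by (rule exI[of _ "[:0, 1:]"]) simp

lemma poly_bounded_cells: "poly_bounded n_cells"
  by (rule poly_bounded_instance_size) (simp add: instance_size_def)

lemma poly_bounded_views: "poly_bounded n_views"
  by (rule poly_bounded_instance_size) (simp add: instance_size_def)

text \<open>The instance size counts users only in products with cells; validity supplies at least
  one cell.\<close>

lemma poly_bounded_users: "poly_bounded n_users"
proof (rule poly_bounded_instance_size)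
  fix I assume "valid_network I"
  then have "n_users I \<le> n_users I * n_cells I"
    by (simp add: valid_network_def)
  then show "n_users I \<le> instance_size I"
    unfolding instance_size_def by linarith
qed

text \<open>Once unfolded, the bound is built from constants and the three cardinalities by sums and
  products only.\<close>

lemma poly_bounded_elva_cost: "poly_bounded elva_cost"
  unfolding elva_cost_def[abs_def] nbar_cost_def nearest_cost_def test_cost_def round_cost_def
    select_cost_def dq_cost_def recompute_cost_def insert_views_cost_def insert_cost_def
    rate_cost_def sinr_cost_def
  by (intro poly_bounded_add poly_bounded_mult poly_bounded_const
      poly_bounded_users poly_bounded_cells poly_bounded_views)

text \<open>\<open>elva_cost\<close> depends only on the cardinalities, neither on \<open>T\<close>
  nor on the real data, so one polynomial can be fixed before the instance and
  \<open>T\<close>.\<close>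

theorem lemma7:
  shows "\<exists>p :: nat poly. \<forall>I T. valid_network I \<and> T > 0 \<longrightarrow>
    (\<exists>x y ops. run (elva_c I T) = Some ((x, y), ops) \<and>
       elva_output I T x y \<and> ops \<le> poly p (instance_size I))"
proof -
  obtain p :: "nat poly" where p: "\<And>I. valid_network I \<Longrightarrow> elva_cost I \<le> poly p (instance_size I)"
    using poly_bounded_elva_cost unfolding poly_bounded_def by blast
  have "\<exists>x y ops. run (elva_c I T) = Some ((x, y), ops) \<and>
      elva_output I T x y \<and> ops \<le> poly p (instance_size I)" if "valid_network I" for I T
    using runs_elva[OF that, of T] p[OF that] unfolding runs_def by (auto intro: le_trans)
  then show ?thesis by blast
qed

end
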